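(* Let $\Phi$ be an infinite field, $r>1$ an integer and $R=\Phi\langle x_1,\ldots,x_r\rangle$ the free associative algebra. Then there exist sequences $(\alpha_{ji})_{i\ge1}$, $j=1,\ldots,r$, of elements of $\Phi$, with corresponding ideals $\Delta_i$ of $R$, where $\Delta_i$ is the right ideal (which is in fact two-sided) generated by $x_1-\alpha_{1i},\ldots,x_r-\alpha_{ri}$, and a cyclic right $R$-module $M$ enjoying the following properties. (a) $M$ has maximal growth. (b) $M$ is triangular. (c) For any factor-module $L$ of $M$ we have $\bigcap_i L_i=\{0\}$, where $L_i=L\Delta_1\cdots\Delta_i$. (d) Any factor-module $L$ of $M$ (including $M$ itself) is residually finite. (e) Any simple section $Q$ of $M$ is one-dimensional.
   Context: Modules are right and unital. A module $M$ over an algebra $R$ is triangular if $M$ has a linear basis $\{e_i : i=1,2,\ldots\}$ such that $e_iu$ lies in the linear span of $\{e_i,e_{i+1},\ldots\}$ for any $u\in R$ and any $i$. A module $M$ is residually finite if for any nonzero $a\in M$ there is a submodule $N\subset M$ such that $a\notin N$ and $\dim M/N<\infty$. A right $R$-module $Q$ is a section of $M$ if $Q\cong N/P$ where $P\subset N$ are submodules of $M$. Growth: $R(n)$ is the span of monomials of degree at most $n$; for a module $V$ generated by a finite set $A$, $g_{A,V}(n)=\dim_\Phi(AR(n))$. Functions $f,g$ are equivalent if for some nonnegative integers $C,C'$ one has $f(n)\le g(n+C)$ and $g(n)\le f(n+C')$ for all $n\ge0$. A finitely generated module has maximal growth if its growth function is equivalent to that of the free module of rank 1, i.e. to $r^n$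 (independently of the finite generating set). *)

theory Defs
  imports
    "HOL-Library.Poly_Mapping"
    "HOL-Algebra.Ideal"
    "Jordan_Normal_Form.VS_Connect"
begin

text \<open>
  The free monoid on \<open>'x\<close>, written additively because \<open>Poly_Mapping\<close> turns
  \<open>'m \<Rightarrow>\<^sub>0 'k\<close> into the monoid algebra of an additively written, not necessarily commutative,
  monoid \<open>'m\<close>.
\<close>

datatype 'x monomial = Monomial (letters: "'x list")

instantiation monomial :: (type) monoid_add
begin

definition zero_monomial :: "'a monomial"
  where "0 = Monomial []"

definition plus_monomial :: "'a monomial \<Rightarrow> 'a monomial \<Rightarrow> 'a monomial"
  where "u + v = Monomial (letters u @ letters v)"

instance
  by standard (simp_all add: zero_monomial_def plus_monomial_def)

end

type_synonym ('k, 'x) free_alg = "'x monomial \<Rightarrow>\<^sub>0 'k"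

definition const :: "'k \<Rightarrow> ('k::field, 'x) free_alg"
  where "const c = Poly_Mapping.single 0 c"

definition var :: "'x \<Rightarrow> ('k::field, 'x) free_alg"
  where "var j = Poly_Mapping.single (Monomial [j]) 1"

text \<open>
  Right modules are stored in the library's record \<open>module\<close>; there \<open>u \<odot>\<^bsub>M\<^esub> m\<close> stands for the
  product \<open>m u\<close>, see \<open>act_assoc\<close>. The components \<open>mult\<close> and \<open>one\<close> of the record play no role.
\<close>

locale right_module = abelian_group M
  for M :: "('r::ring_1, 'm, 'z) module_scheme" (structure) +
  assumes act_closed: "x \<in> carrier M \<Longrightarrow> u \<odot> x \<in> carrier M"
    and act_add_left: "x \<in> carrier M \<Longrightarrow> y \<in> carrier M \<Longrightarrow> u \<odot> (x \<oplus> y) = u \<odot> x \<oplus> u \<odot> y"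
    and act_add_right: "x \<in> carrier M \<Longrightarrow> (u + v) \<odot> x = u \<odot> x \<oplus> v \<odot> x"
    and act_assoc: "x \<in> carrier M \<Longrightarrow> (u * v) \<odot> x = v \<odot> (u \<odot> x)"
    and act_one: "x \<in> carrier M \<Longrightarrow> 1 \<odot> x = x"

definition regular_module :: "('r::ring_1, 'r) module"
  where "regular_module =
    \<lparr>carrier = UNIV, mult = (*), one = 1, zero = 0, add = (+), smult = (\<lambda>u x. x * u)\<rparr>"

definition is_submodule :: "'m set \<Rightarrow> ('r::ring_1, 'm, 'z) module_scheme \<Rightarrow> bool"
  where "is_submodule N M \<longleftrightarrow> additive_subgroup N M \<and> (\<forall>x\<in>N. \<forall>u. u \<odot>\<^bsub>M\<^esub> x \<in> N)"

definition generated_submodule :: "('r::ring_1, 'm, 'z) module_scheme \<Rightarrow> 'm set \<Rightarrow> 'm set"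
  where "generated_submodule M S = \<Inter>{N. is_submodule N M \<and> S \<subseteq> N}"

definition factor_module :: "('r::ring_1, 'm, 'z) module_scheme \<Rightarrow> 'm set \<Rightarrow> ('r, 'm set) module"
  where "factor_module M N =
    \<lparr>carrier = a_rcosets\<^bsub>M\<^esub> N, mult = (\<lambda>_ _. N), one = N, zero = N, add = set_add M,
     smult = (\<lambda>u X. \<Union>x\<in>X. N +>\<^bsub>M\<^esub> (u \<odot>\<^bsub>M\<^esub> x))\<rparr>"

definition isomorphic_modules ::
    "('r::ring_1, 'm, 'y) module_scheme \<Rightarrow> ('r, 'n, 'z) module_scheme \<Rightarrow> bool"
  where "isomorphic_modules M N \<longleftrightarrow> (\<exists>f. bij_betw f (carrier M) (carrier N) \<and>
    (\<forall>x\<in>carrier M. \<forall>y\<in>carrier M. f (x \<oplus>\<^bsub>M\<^esub> y) = f x \<oplus>\<^bsub>N\<^esub> f y) \<and>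
    (\<forall>x\<in>carrier M. \<forall>u. f (u \<odot>\<^bsub>M\<^esub> x) = u \<odot>\<^bsub>N\<^esub> f x))"

definition is_section ::
    "('r::ring_1, 'n, 'y) module_scheme \<Rightarrow> ('r, 'm, 'z) module_scheme \<Rightarrow> bool"
  where "is_section Q M \<longleftrightarrow> right_module Q \<and>
    (\<exists>N P. is_submodule N M \<and> is_submodule P M \<and> P \<subseteq> N \<and>
      isomorphic_modules Q (factor_module (M\<lparr>carrier := N\<rparr>) P))"

definition simple_module :: "('r::ring_1, 'm, 'z) module_scheme \<Rightarrow> bool"
  where "simple_module M \<longleftrightarrow> right_module M \<and> carrier M \<noteq> {\<zero>\<^bsub>M\<^esub>} \<and>
    (\<forall>N. is_submodule N M \<longrightarrow> N = {\<zero>\<^bsub>M\<^esub>} \<or> N = carrier M)"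

text \<open>
  Every cyclic module over \<open>'r\<close> is isomorphic to \<open>factor_module regular_module I\<close> for a right
  ideal \<open>I\<close>, so up to isomorphism all of them have elements of type \<open>'r set\<close>.
\<close>

definition cyclic_module :: "('r::ring_1, 'm, 'z) module_scheme \<Rightarrow> bool"
  where "cyclic_module M \<longleftrightarrow> right_module M \<and> (\<exists>a\<in>carrier M. carrier M = {u \<odot>\<^bsub>M\<^esub> a | u. True})"

definition vs_of :: "(('k::field, 'x) free_alg, 'm, 'z) module_scheme \<Rightarrow> ('k, 'm) module"
  where "vs_of M = \<lparr>carrier = carrier M, mult = mult M, one = one M, zero = zero M, add = add M,
    smult = (\<lambda>c x. const c \<odot>\<^bsub>M\<^esub> x)\<rparr>"

abbreviation lin_span ::
    "(('k::field, 'x) free_alg, 'm, 'z) module_scheme \<Rightarrow> 'm set \<Rightarrow> 'm set"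
  where "lin_span M S \<equiv> LinearCombinations.module.span class_ring (vs_of M) S"

abbreviation lin_basis ::
    "(('k::field, 'x) free_alg, 'm, 'z) module_scheme \<Rightarrow> 'm set \<Rightarrow> bool"
  where "lin_basis M B \<equiv> vectorspace.basis class_ring (vs_of M) B"

abbreviation fin_dim :: "(('k::field, 'x) free_alg, 'm, 'z) module_scheme \<Rightarrow> bool"
  where "fin_dim M \<equiv> vectorspace.fin_dim class_ring (vs_of M)"

abbreviation lin_dim :: "(('k::field, 'x) free_alg, 'm, 'z) module_scheme \<Rightarrow> nat"
  where "lin_dim M \<equiv> vectorspace.dim class_ring (vs_of M)"

definition act_span ::
    "(('k::field, 'x) free_alg, 'm, 'z) module_scheme \<Rightarrow> 'm set \<Rightarrow> ('k, 'x) free_alg set \<Rightarrow> 'm set"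
  where "act_span M A I = lin_span M {u \<odot>\<^bsub>M\<^esub> a | a u. a \<in> A \<and> u \<in> I}"

text \<open>The basis is indexed from \<open>0\<close>.\<close>

definition triangular :: "(('k::field, 'x) free_alg, 'm, 'z) module_scheme \<Rightarrow> bool"
  where "triangular M \<longleftrightarrow> (\<exists>e :: nat \<Rightarrow> 'm. inj e \<and> lin_basis M (range e) \<and>
    (\<forall>i u. u \<odot>\<^bsub>M\<^esub> e i \<in> lin_span M (e ` {i..})))"

definition residually_finite :: "(('k::field, 'x) free_alg, 'm, 'z) module_scheme \<Rightarrow> bool"
  where "residually_finite M \<longleftrightarrow> (\<forall>a\<in>carrier M. a \<noteq> \<zero>\<^bsub>M\<^esub> \<longrightarrow>
    (\<exists>N. is_submodule N M \<and> a \<notin> N \<and> fin_dim (factor_module M N)))"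

text \<open>
  \<open>lin_dim\<close> is unspecified for infinite-dimensional spaces, hence the conjunct \<open>fin_dim M\<close>.
\<close>

definition one_dimensional :: "(('k::field, 'x) free_alg, 'm, 'z) module_scheme \<Rightarrow> bool"
  where "one_dimensional M \<longleftrightarrow> fin_dim M \<and> lin_dim M = 1"

definition bounded_degree :: "nat \<Rightarrow> ('k::field, 'x) free_alg set"
  where "bounded_degree n =
    lin_span regular_module {Poly_Mapping.single w 1 | w. length (letters w) \<le> n}"

definition growth ::
    "(('k::field, 'x::finite) free_alg, 'm, 'z) module_scheme \<Rightarrow> 'm set \<Rightarrow> nat \<Rightarrow> nat"
  where "growth M A n = lin_dim (M\<lparr>carrier := act_span M A (bounded_degree n)\<rparr>)"

definition equivalent_growth :: "(nat \<Rightarrow> nat) \<Rightarrow> (nat \<Rightarrow> nat) \<Rightarrow> bool"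
  where "equivalent_growth f g \<longleftrightarrow> (\<exists>C C'. \<forall>n. f n \<le> g (n + C) \<and> g n \<le> f (n + C'))"

definition finite_generating_set :: "('r::ring_1, 'm, 'z) module_scheme \<Rightarrow> 'm set \<Rightarrow> bool"
  where "finite_generating_set M A \<longleftrightarrow>
    finite A \<and> A \<subseteq> carrier M \<and> generated_submodule M A = carrier M"

definition maximal_growth ::
    "(('k::field, 'x::finite) free_alg, 'm, 'z) module_scheme \<Rightarrow> bool"
  where "maximal_growth M \<longleftrightarrow> (\<exists>A. finite_generating_set M A) \<and>
    (\<forall>A. finite_generating_set M A \<longrightarrow>
      equivalent_growth (growth M A)
        (growth (regular_module :: (('k, 'x) free_alg, ('k, 'x) free_alg) module) {1}))"

definition Delta :: "('x \<Rightarrow> nat \<Rightarrow> 'k) \<Rightarrow> nat \<Rightarrow> ('k::field, 'x) free_alg set"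
  where "Delta \<alpha> i = generated_submodule regular_module {var j - const (\<alpha> j i) | j. True}"

text \<open>\<open>Delta_product L \<alpha> i\<close> is \<open>L \<Delta>\<^sub>1 \<cdots> \<Delta>\<^sub>i\<close>; the value \<open>\<alpha> j 0\<close> is never used.\<close>

fun Delta_product ::
    "(('k::field, 'x) free_alg, 'm, 'z) module_scheme \<Rightarrow> ('x \<Rightarrow> nat \<Rightarrow> 'k) \<Rightarrow> nat \<Rightarrow> 'm set"
  where
    "Delta_product L \<alpha> 0 = carrier L"
  | "Delta_product L \<alpha> (Suc i) = act_span L (Delta_product L \<alpha> i) (Delta \<alpha> (Suc i))"

end

theory Submission
  imports Defs "HOL-Library.Cardinality" "HOL-Library.Discrete_Functions"
    "HOL-Computational_Algebra.Polynomial"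
begin

text \<open>
  Let one letter \<open>c\<close> act diagonally, with distinct eigenvalues, on a space with basis
  \<open>e\<^sub>0, e\<^sub>1, \<dots>\<close>. Then a submodule contains every basis element occurring in one of its members,
  so it is spanned by basis elements. If moreover the action is triangular, every submodule \<open>N\<close> is
  the intersection of the \<open>N + span {e\<^sub>i, e\<^sub>i\<^sub>+\<^sub>1, \<dots>}\<close>, and this gives (c), (d) and (e).

  To obtain maximal growth although \<open>c\<close> is diagonal, the basis is split into finite blocks, and
  every other letter sends \<open>e\<^sub>i\<close> to the sum \<open>b\<close> of a later block of its own. In a block of size \<open>s\<close>
  the vectors \<open>b, b c, \<dots>, b c\<^sup>s\<^sup>-\<^sup>1\<close> are linearly independent (Vandermonde), so all words whose
  runs of \<open>c\<close> are short enough for the blocks send the generator to linearly independent vectors.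
  Blocks whose size grows exponentially with the depth admit every run of \<open>c\<close> that is at most one
  letter longer than the prefix before it, and at least half of the words of any length have only such
  runs.
\<close>

section \<open>The free algebra and its right modules\<close>

text \<open>The obstacle is that a diagonal letter obeys a polynomial equation on every vector: if x
  has s nonzero coordinates, then x, x c, ..., x c^s are dependent. So not all words can act
  independently, and a run of c has to be rationed by the size of the block reached before it.
  Losing a fixed fraction of the words is harmless: growth is compared up to a shift of the
  argument, and for r > 1 a shift by two gains a factor r^2 >= 4.

  A word with m other letters sends the generator into blocks of level at least m. If a run one
  letter longer than its prefix is followed by another letter, then the length of the prefix plus
  two doubles; this is why block l has 2^(l+1) elements.

  A block belongs to one basis element p and one letter j. Restricted to it, a product ending in j
  remembers only the p-th coordinate of the shorter product, and products ending in a different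
  letter other than c vanish. This separates the words by induction on their length.

  The scalars \<open>\<alpha>\<close> are the diagonal entries of the action: the eigenvalues for c,
  and 0 for the other letters, which move every basis element to strictly later ones.\<close>

lemma single_snoc:
  "Poly_Mapping.single (Monomial (w @ [j])) (c::'k::field) = Poly_Mapping.single (Monomial w) c * var j"
  by (simp add: var_def mult_single plus_monomial_def)

lemma const_simps [simp]:
  "const 0 = 0" "const 1 = 1" "const (a + b) = const a + const b" "const (a * b) = const a * const b"
  "const (a - b) = const a - const b" "const (- a) = - const a"
  by (simp_all add: const_def single_add single_one mult_single single_diff single_uminus)

lemma const_commute: "const c * u = u * const (c::'k::field)"
proof (induction u rule: update_induct)
  case const then show ?case by simp
next
  case (update f w b)
  have "Poly_Mapping.update w b f = f + Poly_Mapping.single w b"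
    by (rule poly_mapping_eqI) (use update(1) in \<open>auto simp: lookup_update lookup_add lookup_single when_def in_keys_iff\<close>)
  then show ?case using update.IH by (simp add: const_def mult_single algebra_simps)
qed

lemma free_alg_induct [case_names zero single add]:
  fixes u :: "('k::field, 'x) free_alg"
  assumes "P 0" "\<And>w c. P (Poly_Mapping.single (Monomial w) c)" "\<And>u v. P u \<Longrightarrow> P v \<Longrightarrow> P (u + v)"
  shows "P u"
proof (induction u rule: update_induct)
  case const then show ?case using assms by simp
next
  case (update f w b)
  have "Poly_Mapping.update w b f = f + Poly_Mapping.single w b"
    by (rule poly_mapping_eqI) (use update(1) in \<open>auto simp: lookup_update lookup_add lookup_single when_def in_keys_iff\<close>)
  then show ?case using update.IH assms by (cases w) simp
qed

text \<open>Every word arises from a scalar by appending letters on the right. The lemma serves both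
  to reduce stability under the algebra to stability under the letters and to compute modulo
  \<open>Delta\<close>.\<close>

lemma right_ideal_UNIV:
  fixes W :: "('k::field, 'x) free_alg set"
  assumes "\<And>c. const c \<in> W" "\<And>u v. u \<in> W \<Longrightarrow> v \<in> W \<Longrightarrow> u + v \<in> W" "\<And>u j. u \<in> W \<Longrightarrow> u * var j \<in> W"
  shows "u \<in> W"
proof (induction u rule: free_alg_induct)
  case zero
  then show ?case using assms(1)[of 0] by simp
next
  case (single w c)
  show ?case
  proof (induction w rule: rev_induct)
    case Nil then show ?case using assms(1)[of c] by (simp add: const_def zero_monomial_def)
  next
    case (snoc j w) then show ?case using assms(3) by (simp add: single_snoc)
  qed
next
  case (add u v) then show ?case using assms(2) by blast
qed

context right_module
begin

lemma act_zero: "u \<odot> \<zero> = \<zero>"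
proof -
  have "u \<odot> \<zero> \<oplus> u \<odot> \<zero> = u \<odot> \<zero>"
    using act_add_left[of \<zero> \<zero> u] by simp
  then show ?thesis by (simp add: act_closed)
qed

lemma zero_act:
  assumes "x \<in> carrier M"
  shows "0 \<odot> x = \<zero>"
proof -
  have "0 \<odot> x \<oplus> 0 \<odot> x = 0 \<odot> x"
    using act_add_right[OF assms, of 0 0] by simp
  then show ?thesis by (simp add: act_closed assms)
qed

lemma minus_act:
  assumes "x \<in> carrier M"
  shows "(- u) \<odot> x = \<ominus> (u \<odot> x)"
proof (rule sym, rule minus_equality)
  have "(- u) \<odot> x \<oplus> u \<odot> x = (- u + u) \<odot> x"
    using act_add_right[OF assms, of "- u" u] by metis
  then show "(- u) \<odot> x \<oplus> u \<odot> x = \<zero>" by (simp add: zero_act assms)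
qed (simp_all add: act_closed assms)

lemma diff_act:
  assumes "x \<in> carrier M"
  shows "(u - v) \<odot> x = u \<odot> x \<ominus> v \<odot> x"
  using act_add_right[OF assms, of u "- v"] by (simp add: minus_act assms a_minus_def)

end

lemma is_submoduleD:
  assumes "right_module M" "is_submodule N M"
  shows "N \<subseteq> carrier M" "\<zero>\<^bsub>M\<^esub> \<in> N"
    "x \<in> N \<Longrightarrow> y \<in> N \<Longrightarrow> x \<oplus>\<^bsub>M\<^esub> y \<in> N"
    "x \<in> N \<Longrightarrow> \<ominus>\<^bsub>M\<^esub> x \<in> N"
    "x \<in> N \<Longrightarrow> u \<odot>\<^bsub>M\<^esub> x \<in> N"
proof -
  interpret right_module M by fact
  interpret additive_subgroup N M using assms(2) by (simp add: is_submodule_def)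
  show "N \<subseteq> carrier M" "\<zero>\<^bsub>M\<^esub> \<in> N"
    "x \<in> N \<Longrightarrow> y \<in> N \<Longrightarrow> x \<oplus>\<^bsub>M\<^esub> y \<in> N"
    "x \<in> N \<Longrightarrow> \<ominus>\<^bsub>M\<^esub> x \<in> N"
    "x \<in> N \<Longrightarrow> u \<odot>\<^bsub>M\<^esub> x \<in> N"
    using assms(2) a_subset by (auto simp: is_submodule_def)
qed

text \<open>Closure under negatives comes from the action of -1.\<close>

lemma is_submoduleI:
  assumes "right_module M" "N \<subseteq> carrier M" "\<zero>\<^bsub>M\<^esub> \<in> N"
    and "\<And>x y. x \<in> N \<Longrightarrow> y \<in> N \<Longrightarrow> x \<oplus>\<^bsub>M\<^esub> y \<in> N"
    and act: "\<And>x u. x \<in> N \<Longrightarrow> u \<odot>\<^bsub>M\<^esub> x \<in> N"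
  shows "is_submodule N M"
proof -
  interpret right_module M by fact
  have inv: "\<ominus>\<^bsub>M\<^esub> x \<in> N" if "x \<in> N" for x
  proof -
    have "(- 1) \<odot>\<^bsub>M\<^esub> x = \<ominus>\<^bsub>M\<^esub> x" using that assms(2) minus_act[of x 1] act_one by auto
    then show ?thesis using act that by metis
  qed
  have "subgroup N (add_monoid M)"
    using assms inv by (intro add.subgroupI) (auto simp: a_inv_def)
  then show ?thesis using act by (simp add: is_submodule_def additive_subgroup_def)
qed

text \<open>The subspaces of \<open>vs_of M\<close> by bare closure conditions, see
  \<open>subspace_vs_of_iff\<close>; most arguments below test these conditions directly.\<close>

definition linear_subspace :: "(('k::field, 'x) free_alg, 'm, 'z) module_scheme \<Rightarrow> 'm set \<Rightarrow> bool"
  where "linear_subspace M W \<longleftrightarrow> W \<subseteq> carrier M \<and> \<zero>\<^bsub>M\<^esub> \<in> W \<and>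
    (\<forall>x\<in>W. \<forall>y\<in>W. x \<oplus>\<^bsub>M\<^esub> y \<in> W) \<and> (\<forall>c. \<forall>x\<in>W. const c \<odot>\<^bsub>M\<^esub> x \<in> W)"

lemma submodule_imp_linear_subspace:
  "right_module M \<Longrightarrow> is_submodule N M \<Longrightarrow> linear_subspace M N"
  using is_submoduleD[of M N] by (auto simp: linear_subspace_def)

lemma linear_subspace_act_mem:
  assumes "right_module M" "linear_subspace M W" "\<And>x j. x \<in> W \<Longrightarrow> var j \<odot>\<^bsub>M\<^esub> x \<in> W" "x \<in> W"
  shows "u \<odot>\<^bsub>M\<^esub> x \<in> W"
proof -
  interpret right_module M by fact
  have "u \<in> {u. \<forall>x\<in>W. u \<odot>\<^bsub>M\<^esub> x \<in> W}"
  proof (rule right_ideal_UNIV)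
    show "u + v \<in> {u. \<forall>x\<in>W. u \<odot>\<^bsub>M\<^esub> x \<in> W}"
      if "u \<in> {u. \<forall>x\<in>W. u \<odot>\<^bsub>M\<^esub> x \<in> W}" "v \<in> {u. \<forall>x\<in>W. u \<odot>\<^bsub>M\<^esub> x \<in> W}" for u v
      using that assms(2) by (auto simp: linear_subspace_def act_add_right subset_eq)
    show "u * var j \<in> {u. \<forall>x\<in>W. u \<odot>\<^bsub>M\<^esub> x \<in> W}" if "u \<in> {u. \<forall>x\<in>W. u \<odot>\<^bsub>M\<^esub> x \<in> W}" for u j
      using that assms(2,3) by (auto simp: linear_subspace_def act_assoc subset_eq)
  qed (use assms(2) in \<open>auto simp: linear_subspace_def\<close>)
  then show ?thesis using assms(4) by blast
qed

lemma linear_subspace_imp_submodule: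
  assumes "right_module M" "linear_subspace M W" "\<And>x j. x \<in> W \<Longrightarrow> var j \<odot>\<^bsub>M\<^esub> x \<in> W"
  shows "is_submodule W M"
  using assms linear_subspace_act_mem[OF assms]
  by (intro is_submoduleI) (auto simp: linear_subspace_def)

definition linear_functional :: "(('k::field, 'x) free_alg, 'm, 'z) module_scheme \<Rightarrow> ('m \<Rightarrow> 'k) \<Rightarrow> bool"
  where "linear_functional M \<phi> \<longleftrightarrow>
    (\<forall>x\<in>carrier M. \<forall>y\<in>carrier M. \<phi> (x \<oplus>\<^bsub>M\<^esub> y) = \<phi> x + \<phi> y) \<and>
    (\<forall>c. \<forall>x\<in>carrier M. \<phi> (const c \<odot>\<^bsub>M\<^esub> x) = c * \<phi> x)"

section \<open>The underlying vector space: spans, dimension bounds and independence\<close>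

lemma vs_of_simps [simp]:
  "carrier (vs_of M) = carrier M" "zero (vs_of M) = zero M" "add (vs_of M) = add M"
  "smult (vs_of M) = (\<lambda>c x. const c \<odot>\<^bsub>M\<^esub> x)"
  by (simp_all add: vs_of_def)

lemma vs_of_carrier_update: "vs_of (M\<lparr>carrier := S\<rparr>) = (vs_of M)\<lparr>carrier := S\<rparr>"
  by (simp add: vs_of_def)

lemma vectorspace_vs_of:
  fixes M :: "(('k::field, 'x) free_alg, 'm, 'z) module_scheme"
  assumes "right_module M"
  shows "vectorspace class_ring (vs_of M)"
proof -
  interpret right_module M by fact
  have "Module.module class_ring (vs_of M)"
  proof (rule moduleI)
    show "cring (class_ring :: 'k ring)" by (rule class_cring.is_cring)
    show "abelian_group (vs_of M)"
      by (rule abelian_groupI) (auto simp: a_ac intro!: bexI[of _ "\<ominus>\<^bsub>M\<^esub> x" for x] r_neg)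
    show "(a \<otimes>\<^bsub>class_ring\<^esub> b) \<odot>\<^bsub>vs_of M\<^esub> x = a \<odot>\<^bsub>vs_of M\<^esub> (b \<odot>\<^bsub>vs_of M\<^esub> x)"
      if "x \<in> carrier (vs_of M)" for a b :: 'k and x
      \<comment> \<open>A right action reverses products, which is harmless for scalars because they
        commute.\<close>
      using that act_assoc[of x "const b" "const a"] by (simp add: mult.commute[of a b])
  qed (auto simp: act_closed act_add_left act_add_right act_one)
  then show ?thesis by (simp add: vectorspace_def class_field)
qed

lemma subspace_vs_of_iff:
  assumes "right_module M"
  shows "VectorSpace.subspace class_ring W (vs_of M) \<longleftrightarrow> linear_subspace M W"
  using vectorspace_vs_of[OF assms] vectorspace.axioms(1)[OF vectorspace_vs_of[OF assms]]
  by (auto simp: VectorSpace.subspace_def LinearCombinations.submodule_def linear_subspace_def)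

context
  fixes M :: "(('k::field, 'x) free_alg, 'm, 'z) module_scheme"
  assumes M: "right_module M"
begin

interpretation vs: vectorspace class_ring "vs_of M"
  by (rule vectorspace_vs_of[OF M])

lemma linear_subspace_lin_span: "S \<subseteq> carrier M \<Longrightarrow> linear_subspace M (lin_span M S)"
  using vs.span_is_subspace[of S] by (simp add: subspace_vs_of_iff[OF M])

lemma lin_span_superset: "S \<subseteq> carrier M \<Longrightarrow> S \<subseteq> lin_span M S"
  using vs.in_own_span[of S] by simp

lemma lin_span_minimal: "linear_subspace M W \<Longrightarrow> S \<subseteq> W \<Longrightarrow> lin_span M S \<subseteq> W"
  using vs.span_is_subset[of S W] subspace_vs_of_iff[OF M, of W] by (simp add: VectorSpace.subspace_def)

lemma lin_span_mono: "S \<subseteq> T \<Longrightarrow> lin_span M S \<subseteq> lin_span M T"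
  by (rule vs.span_is_monotone)

lemma lin_span_subset_carrier: "S \<subseteq> carrier M \<Longrightarrow> lin_span M S \<subseteq> carrier M"
  using linear_subspace_lin_span by (auto simp: linear_subspace_def)

lemma linear_subspace_vs: "linear_subspace M W \<Longrightarrow> vectorspace class_ring (vs_of (M\<lparr>carrier := W\<rparr>))"
  using vs.subspace_is_vs[of W] by (simp add: subspace_vs_of_iff[OF M] vs_of_carrier_update)

lemma fin_dim_iff:
  "fin_dim M \<longleftrightarrow> (\<exists>A. finite A \<and> A \<subseteq> carrier M \<and> carrier M \<subseteq> lin_span M A)"
  unfolding vs.fin_dim_def using lin_span_subset_carrier by (auto simp: set_eq_subset)

text \<open>The set X need not lie in W, and the ambient space may have infinite dimension. The
  exchange lemma in the ambient space bounds the independent subsets of W, so there is a maximal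
  one, and it is a basis of W.\<close>

lemma lin_dim_subspace_le:
  assumes "linear_subspace M W" "finite X" "X \<subseteq> carrier M" "W \<subseteq> lin_span M X"
  shows "fin_dim (M\<lparr>carrier := W\<rparr>)"
    "lin_dim (M\<lparr>carrier := W\<rparr>) \<le> card X"
proof -
  interpret W: vectorspace class_ring "vs_of (M\<lparr>carrier := W\<rparr>)"
    by (rule linear_subspace_vs) fact
  have sub: "LinearCombinations.submodule class_ring W (vs_of M)"
    using assms(1) M subspace_vs_of_iff[of M W] by (simp add: VectorSpace.subspace_def)
  have dep_eq: "W.lin_dep A = vs.lin_dep A" if "A \<subseteq> W" for A
    using vs.span_li_not_depend(2)[OF that sub] by (simp add: vs_of_carrier_update)
  have card_le: "finite A \<and> card A \<le> card X" if A: "A \<subseteq> W" "\<not> W.lin_dep A" for A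
  proof -
    have le: "card B \<le> card X" if B: "B \<subseteq> A" "finite B" for B
    proof -
      have li: "\<not> vs.lin_dep B"
        using vs.subset_li_is_li[of A B] A B dep_eq by blast
      have "X \<subseteq> carrier (vs_of M)" "B \<subseteq> lin_span M X" using B A assms(3,4) by auto
      \<comment> \<open>Exchange leaves a set C whose cardinality is at most the integer
        \<open>card X - card B\<close>; as it is nonnegative, \<open>card B\<close> is at most
        \<open>card X\<close>.\<close>
      from vs.replacement[OF B(2) assms(2) this(1) li this(2)]
      obtain C :: "'m set" where "int (card C) \<le> int (card X) - int (card B)" by (elim exE conjE)
      then show ?thesis by linarith
    qed
    have "finite A"
    proof (rule ccontr)
      assume "infinite A"
      then obtain B where "B \<subseteq> A" "finite B" "card B = card X + 1"
        by (metis infinite_arbitrarily_large)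
      then show False using le[of B] by simp
    qed
    then show ?thesis using le by blast
  qed
  have "\<exists>A. finite A \<and> maximal A (\<lambda>S. S \<subseteq> W \<and> \<not> W.lin_dep S)"
    by (rule maximal_exists[where B = "{}"]) (use card_le in \<open>auto simp: W.lin_dep_def\<close>)
  then obtain A where A: "finite A" "maximal A (\<lambda>S. S \<subseteq> W \<and> \<not> W.lin_dep S)" by blast
  then have basis: "W.basis A" using W.max_li_is_basis[of A] by simp
  then show "W.fin_dim" using A(1) by (auto simp: W.fin_dim_def W.basis_def)
  show "W.dim \<le> card X"
    using W.dim_basis[OF A(1) basis] card_le[of A] A(2) by (simp add: maximal_def)
qed

lemma linear_functional_zero:
  assumes "linear_functional M \<phi>"
  shows "\<phi> \<zero>\<^bsub>M\<^esub> = 0"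
proof -
  have "\<zero>\<^bsub>M\<^esub> \<in> carrier M" using vs.zero_closed by simp
  then have "\<phi> (\<zero>\<^bsub>M\<^esub> \<oplus>\<^bsub>M\<^esub> \<zero>\<^bsub>M\<^esub>) = \<phi> \<zero>\<^bsub>M\<^esub> + \<phi> \<zero>\<^bsub>M\<^esub>"
    using assms unfolding linear_functional_def by blast
  moreover have "\<zero>\<^bsub>M\<^esub> \<oplus>\<^bsub>M\<^esub> \<zero>\<^bsub>M\<^esub> = \<zero>\<^bsub>M\<^esub>" using vs.M.r_zero[OF vs.zero_closed] by simp
  ultimately show ?thesis by (metis add_cancel_right_right)
qed

lemma linear_functional_lincomb:
  assumes "linear_functional M \<phi>" "finite A" "A \<subseteq> carrier M"
  shows "\<phi> (vs.lincomb a A) = (\<Sum>v\<in>A. a v * \<phi> v)"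
  using assms(2,3)
proof (induction A rule: finite_induct)
  case empty
  then show ?case by (simp add: vs.lincomb_def linear_functional_zero[OF assms(1)])
next
  case (insert v A)
  have "vs.lincomb a (insert v A) = const (a v) \<odot>\<^bsub>M\<^esub> v \<oplus>\<^bsub>M\<^esub> vs.lincomb a A"
    using insert vs.lincomb_insert2[of A a v] by simp
  moreover have "const (a v) \<odot>\<^bsub>M\<^esub> v \<in> carrier M" "vs.lincomb a A \<in> carrier M"
    using insert vs.smult_closed[of "a v" v] vs.lincomb_closed[of A a] by auto
  ultimately show ?case
    using insert assms(1) by (simp add: linear_functional_def)
qed

text \<open>Every functional kills a vanishing combination, so independence can be tested on
  coordinates. The family is indexed because words are counted later, and the count passes to the
  image only with injectivity.\<close>

lemma lin_indpt_familyI: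
  assumes "f ` I \<subseteq> carrier M" "\<And>n. linear_functional M (\<phi> n)"
    and indep: "\<And>J c. finite J \<Longrightarrow> J \<subseteq> I \<Longrightarrow> (\<forall>n. (\<Sum>i\<in>J. c i * \<phi> n (f i)) = 0) \<Longrightarrow> \<forall>i\<in>J. c i = 0"
  shows "inj_on f I" "\<not> vs.lin_dep (f ` I)"
proof -
  show inj: "inj_on f I"
  proof (rule inj_onI, rule ccontr)
    fix i j assume *: "i \<in> I" "j \<in> I" "f i = f j" "i \<noteq> j"
    \<comment> \<open>Two equal members would admit the coefficients 1 and -1.\<close>
    have "\<forall>k\<in>{i, j}. (if k = i then 1 else (-1 :: 'k)) = 0"
      by (rule indep) (use * in auto)
    then show False by simp
  qed
  show "\<not> vs.lin_dep (f ` I)"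
  proof
    assume "vs.lin_dep (f ` I)"
    then obtain A a v where A: "finite A" "A \<subseteq> f ` I" "vs.lincomb a A = \<zero>\<^bsub>M\<^esub>" "v \<in> A" "a v \<noteq> 0"
      by (auto simp: vs.lin_dep_def)
    obtain J where J: "J \<subseteq> I" "A = f ` J" using A(2) by (auto simp: subset_image_iff)
    have inj_J: "inj_on f J" using inj J(1) by (rule inj_on_subset)
    have "finite J" using A(1) J(2) inj_J by (simp add: finite_image_iff)
    have "(\<Sum>i\<in>J. a (f i) * \<phi> n (f i)) = 0" for n
    proof -
      have "(\<Sum>i\<in>J. a (f i) * \<phi> n (f i)) = (\<Sum>v\<in>A. a v * \<phi> n v)"
        by (simp add: J(2) sum.reindex[OF inj_J])
      also have "\<dots> = \<phi> n (vs.lincomb a A)"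
        using linear_functional_lincomb[OF assms(2) A(1)] A(2) assms(1) by auto
      also have "\<dots> = 0"
        unfolding A(3) using linear_functional_zero[OF assms(2)] by simp
      finally show ?thesis .
    qed
    then have "\<forall>i\<in>J. a (f i) = 0" by (intro indep \<open>finite J\<close> J(1)) auto
    then show False using A(4,5) J(2) by auto
  qed
qed

lemma card_le_lin_dim_subspace:
  assumes "linear_subspace M W" "fin_dim (M\<lparr>carrier := W\<rparr>)"
    and "f ` I \<subseteq> W" "\<And>n. linear_functional M (\<phi> n)"
    and indep: "\<And>J c. finite J \<Longrightarrow> J \<subseteq> I \<Longrightarrow> (\<forall>n. (\<Sum>i\<in>J. c i * \<phi> n (f i)) = 0) \<Longrightarrow> \<forall>i\<in>J. c i = 0"
  shows "card I \<le> lin_dim (M\<lparr>carrier := W\<rparr>)"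
proof -
  interpret W: vectorspace class_ring "vs_of (M\<lparr>carrier := W\<rparr>)"
    by (rule linear_subspace_vs) fact
  have sub: "LinearCombinations.submodule class_ring W (vs_of M)"
    using assms(1) M subspace_vs_of_iff[of M W] by (simp add: VectorSpace.subspace_def)
  have "f ` I \<subseteq> carrier M" using assms(1,3) by (auto simp: linear_subspace_def)
  note indpt = lin_indpt_familyI[OF this assms(4) indep]
  have "\<not> W.lin_dep (f ` I)"
    using indpt(2) vs.span_li_not_depend(2)[OF assms(3) sub] by (simp add: vs_of_carrier_update)
  then have "card (f ` I) \<le> W.dim"
    using W.li_le_dim(2)[OF assms(2), of "f ` I"] assms(3) by simp
  then show ?thesis by (simp add: card_image indpt(1))
qed

end

section \<open>Submodules and factor modules as modules, and the regular module\<close>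

lemma right_module_carrier_update:
  assumes "right_module M" "is_submodule N M"
  shows "right_module (M\<lparr>carrier := N\<rparr>)"
proof -
  interpret right_module M by fact
  note N = is_submoduleD[OF assms]
  have "abelian_group (M\<lparr>carrier := N\<rparr>)"
  proof (rule abelian_groupI)
    show "\<exists>y\<in>carrier (M\<lparr>carrier := N\<rparr>). y \<oplus>\<^bsub>M\<lparr>carrier := N\<rparr>\<^esub> x = \<zero>\<^bsub>M\<lparr>carrier := N\<rparr>\<^esub>"
      if "x \<in> carrier (M\<lparr>carrier := N\<rparr>)" for x
      using that N l_neg[of x] by (auto intro!: bexI[of _ "\<ominus>\<^bsub>M\<^esub> x"])
  qed (use N in \<open>auto simp: a_ac subset_eq\<close>)
  then show ?thesis
    using N by (auto simp: right_module_def right_module_axioms_def subset_eq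
        act_closed act_add_left act_add_right act_assoc act_one)
qed

context
  fixes M :: "('r::ring_1, 'm, 'z) module_scheme" and N :: "'m set"
  assumes M: "right_module M" and N: "is_submodule N M"
begin

interpretation right_module M by (rule M)

interpretation abelian_subgroup N M
  using N by (intro abelian_subgroupI3) (auto simp: is_submodule_def abelian_group_axioms)

lemma carrier_factor_module: "carrier (factor_module M N) = (\<lambda>x. N +>\<^bsub>M\<^esub> x) ` carrier M"
  by (auto simp: factor_module_def A_RCOSETS_def' )

lemma zero_factor_module: "\<zero>\<^bsub>factor_module M N\<^esub> = N +>\<^bsub>M\<^esub> \<zero>\<^bsub>M\<^esub>"
  by (simp add: factor_module_def a_subset)

lemma coset_eq_iff:
  assumes "x \<in> carrier M" "y \<in> carrier M"
  shows "N +>\<^bsub>M\<^esub> x = N +>\<^bsub>M\<^esub> y \<longleftrightarrow> x \<ominus>\<^bsub>M\<^esub> y \<in> N"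
proof -
  have "N +>\<^bsub>M\<^esub> x = N +>\<^bsub>M\<^esub> y \<longleftrightarrow> x \<in> N +>\<^bsub>M\<^esub> y"
    using a_repr_independence'[of x y] a_rcos_self[OF assms(1)] assms by blast
  then show ?thesis using a_rcos_module[OF assms(2,1)] by (simp add: a_minus_def)
qed

lemma coset_eq_zero_iff:
  assumes "x \<in> carrier M"
  shows "N +>\<^bsub>M\<^esub> x = \<zero>\<^bsub>factor_module M N\<^esub> \<longleftrightarrow> x \<in> N"
proof -
  have minus_zero: "\<ominus>\<^bsub>M\<^esub> \<zero>\<^bsub>M\<^esub> = \<zero>\<^bsub>M\<^esub>" by (rule minus_equality) simp_all
  show ?thesis
    using coset_eq_iff[OF assms, of "\<zero>\<^bsub>M\<^esub>"] assms
    by (simp add: zero_factor_module a_minus_def minus_zero)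
qed

lemma coset_add:
  "x \<in> carrier M \<Longrightarrow> y \<in> carrier M \<Longrightarrow>
    (N +>\<^bsub>M\<^esub> x) \<oplus>\<^bsub>factor_module M N\<^esub> (N +>\<^bsub>M\<^esub> y) = N +>\<^bsub>M\<^esub> (x \<oplus>\<^bsub>M\<^esub> y)"
  by (simp add: factor_module_def a_rcos_sum)

text \<open>The action on a coset is defined as a union over all its representatives; since N is a
  submodule, the members of this union coincide.\<close>

lemma coset_act:
  assumes "x \<in> carrier M"
  shows "u \<odot>\<^bsub>factor_module M N\<^esub> (N +>\<^bsub>M\<^esub> x) = N +>\<^bsub>M\<^esub> (u \<odot>\<^bsub>M\<^esub> x)"
proof -
  have "N +>\<^bsub>M\<^esub> (u \<odot>\<^bsub>M\<^esub> y) = N +>\<^bsub>M\<^esub> (u \<odot>\<^bsub>M\<^esub> x)" if "y \<in> N +>\<^bsub>M\<^esub> x" for y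
  proof -
    obtain n where n: "n \<in> N" "y = n \<oplus>\<^bsub>M\<^esub> x" using \<open>y \<in> N +>\<^bsub>M\<^esub> x\<close> by (auto simp: a_r_coset_def')
    have "u \<odot>\<^bsub>M\<^esub> n \<in> N" using n(1) by (rule is_submoduleD(5)[OF M N])
    then have "u \<odot>\<^bsub>M\<^esub> y \<in> N +>\<^bsub>M\<^esub> (u \<odot>\<^bsub>M\<^esub> x)"
      using n assms a_subset by (auto simp: a_r_coset_def' act_add_left)
    then show ?thesis using a_repr_independence'[of "u \<odot>\<^bsub>M\<^esub> y" "u \<odot>\<^bsub>M\<^esub> x"] assms act_closed by simp
  qed
  then have "(\<Union>y\<in>N +>\<^bsub>M\<^esub> x. N +>\<^bsub>M\<^esub> (u \<odot>\<^bsub>M\<^esub> y)) = (\<Union>y\<in>N +>\<^bsub>M\<^esub> x. N +>\<^bsub>M\<^esub> (u \<odot>\<^bsub>M\<^esub> x))"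
    by (intro SUP_cong refl)
  moreover have "N +>\<^bsub>M\<^esub> x \<noteq> {}" using a_rcos_self[OF assms] by blast
  ultimately show ?thesis by (simp add: factor_module_def)
qed

lemma right_module_factor_module: "right_module (factor_module M N)"
proof -
  have "abelian_group (factor_module M N)"
  proof (rule abelian_groupI)
    fix X assume "X \<in> carrier (factor_module M N)"
    then obtain x where x: "x \<in> carrier M" "X = N +>\<^bsub>M\<^esub> x" by (auto simp: carrier_factor_module)
    then have "(N +>\<^bsub>M\<^esub> (\<ominus>\<^bsub>M\<^esub> x)) \<oplus>\<^bsub>factor_module M N\<^esub> X = \<zero>\<^bsub>factor_module M N\<^esub>"
      by (simp add: coset_add zero_factor_module l_neg)
    then show "\<exists>Y\<in>carrier (factor_module M N). Y \<oplus>\<^bsub>factor_module M N\<^esub> X = \<zero>\<^bsub>factor_module M N\<^esub>"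
      using x by (auto simp: carrier_factor_module)
  qed (auto simp: carrier_factor_module zero_factor_module coset_add a_ac)
  then show ?thesis
    by (auto simp: right_module_def right_module_axioms_def carrier_factor_module coset_add coset_act
        act_closed act_add_left act_add_right act_assoc act_one)
qed

end

lemma generated_submodule_subset: "is_submodule N M \<Longrightarrow> S \<subseteq> N \<Longrightarrow> generated_submodule M S \<subseteq> N"
  by (auto simp: generated_submodule_def)

lemma is_submodule_carrier:
  assumes "right_module M"
  shows "is_submodule (carrier M) M"
proof -
  interpret right_module M by fact
  show ?thesis by (rule is_submoduleI[OF assms]) (simp_all add: act_closed)
qed

lemma generated_submodule_superset: "S \<subseteq> generated_submodule M S"
  by (auto simp: generated_submodule_def)

lemma is_submodule_generated:
  assumes "right_module M" "S \<subseteq> carrier M"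
  shows "is_submodule (generated_submodule M S) M"
proof (rule is_submoduleI[OF assms(1)])
  show "generated_submodule M S \<subseteq> carrier M"
    by (rule generated_submodule_subset) (use assms is_submodule_carrier in auto)
qed (use is_submoduleD(2,3,5)[OF assms(1)] in \<open>unfold generated_submodule_def, blast+\<close>)

lemma right_module_regular: "right_module (regular_module :: ('r::ring_1, 'r) module)"
proof -
  have "abelian_group (regular_module :: ('r, 'r) module)"
  proof (rule abelian_groupI)
    show "\<exists>y\<in>carrier regular_module. y \<oplus>\<^bsub>regular_module\<^esub> x = \<zero>\<^bsub>regular_module\<^esub>" for x :: 'r
      by (rule bexI[of _ "- x"]) (simp_all add: regular_module_def)
  qed (simp_all add: regular_module_def add_ac)
  then show ?thesis
    by (auto simp: right_module_def right_module_axioms_def regular_module_def algebra_simps)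
qed

lemma regular_module_simps [simp]:
  "carrier regular_module = UNIV" "\<zero>\<^bsub>regular_module\<^esub> = 0"
  "x \<oplus>\<^bsub>regular_module\<^esub> y = x + y" "u \<odot>\<^bsub>regular_module\<^esub> x = x * u"
  by (simp_all add: regular_module_def)

section \<open>Words with short runs\<close>

definition lead_run :: "'x \<Rightarrow> 'x list \<Rightarrow> nat"
  where "lead_run c w = length (takeWhile (\<lambda>x. x = c) w)"

text \<open>The head of the list is the letter that acts last. For a maximal run of length k in
  front of a remainder v, the condition at the last prepended c says k - 1 <= |v|; at the earlier
  ones it is weaker.\<close>

primrec sparse_word :: "'x \<Rightarrow> 'x list \<Rightarrow> bool" where
  "sparse_word c [] \<longleftrightarrow> True"
| "sparse_word c (x # w) \<longleftrightarrow> sparse_word c w \<and> (x = c \<longrightarrow> 2 * lead_run c w \<le> length w)"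

abbreviation others :: "'x \<Rightarrow> 'x list \<Rightarrow> nat"
  where "others c w \<equiv> length (filter (\<lambda>x. x \<noteq> c) w)"

lemma lead_run_simps [simp]:
  "lead_run c [] = 0" "lead_run c (x # w) = (if x = c then Suc (lead_run c w) else 0)"
  by (simp_all add: lead_run_def)

lemma lead_run_replicate_append:
  "u = [] \<or> hd u \<noteq> c \<Longrightarrow> lead_run c (replicate k c @ u) = k"
  by (induction k) (cases u; auto)+

lemma replicate_lead_run: "w = replicate (lead_run c w) c @ dropWhile (\<lambda>x. x = c) w"
  by (induction w) auto

text \<open>Let v be the word without its leading run, of length k, and let m be its number of other
  letters. The claim is |v| + 2 <= 2^(m+1) and k <= |v| + 1. Prepending another letter makes the new
  remainder plus two equal to |v| + k + 3, which is at most 2 (|v| + 2).\<close>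

lemma sparse_word_bounds:
  "sparse_word c w \<Longrightarrow> length w + 2 \<le> 2 ^ Suc (others c w) + lead_run c w \<and> 2 * lead_run c w \<le> Suc (length w)"
  by (induction w) auto

text \<open>The run is shorter than a block of level \<open>others c w\<close>; this matches the
  block size to sparseness.\<close>

lemma lead_run_less:
  "sparse_word c w \<Longrightarrow> lead_run c w < 2 ^ Suc (others c w)"
  using sparse_word_bounds[of c w] by linarith

lemma sparse_word_append: "sparse_word c (u @ w) \<Longrightarrow> sparse_word c w"
  by (induction u) auto

text \<open>Prepending a letter to a sparse word spoils sparseness only if the letter is c and the
  leading run already exceeds half of the word. The second summand counts these failures.\<close>

lemma card_sparse_words_Suc:
  fixes c :: "'x::finite"
  shows "card {w. length w = Suc n \<and> sparse_word c w} + card {w. length w = n \<and> sparse_word c w \<and> n < 2 * lead_run c w}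
    = CARD('x) * card {w. length w = n \<and> sparse_word c w}" (is "card ?A' + card ?B = _ * card ?A")
proof -
  have fin: "finite {w :: 'x list. length w = m \<and> P w}" for m P
    by (rule finite_subset[OF _ finite_lists_length_eq[of UNIV m]]) auto
  have "card ?A' + card ?B = card ?A' + card ((#) c ` ?B)"
    by (simp add: card_image)
  also have "\<dots> = card (?A' \<union> (#) c ` ?B)"
    by (rule card_Un_disjoint[symmetric]) (use fin in auto)
  also have "?A' \<union> (#) c ` ?B = (\<lambda>(x, w). x # w) ` (UNIV \<times> ?A)"
    by (auto simp: length_Suc_conv image_iff)
  also have "card \<dots> = CARD('x) * card ?A"
    by (subst card_image) (auto simp: inj_on_def card_cartesian_product)
  finally show ?thesis .
qed

text \<open>In a sparse word of length 2d + 1, a leading run longer than half has exactly d + 1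
  letters, so the other d letters determine the word.\<close>

lemma card_maximal_run_le:
  fixes c :: "'x::finite"
  shows "card {w. length w = Suc (2 * d) \<and> sparse_word c w \<and> Suc (2 * d) < 2 * lead_run c w} \<le> CARD('x) ^ d"
    (is "card ?B \<le> _")
proof -
  have fin: "finite {w :: 'x list. length w = d}"
    using finite_lists_length_eq[of "UNIV :: 'x set" d] by simp
  have "?B \<subseteq> (\<lambda>u. replicate (Suc d) c @ u) ` {w. length w = d}"
  proof
    fix w assume w: "w \<in> ?B"
    then have "lead_run c w = Suc d" using sparse_word_bounds[of c w] by auto
    then have eq: "w = replicate (Suc d) c @ dropWhile (\<lambda>x. x = c) w" using replicate_lead_run[of w c] by simp
    moreover have "length (dropWhile (\<lambda>x. x = c) w) = d"
      using arg_cong[OF eq, of length] w by simp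
    ultimately show "w \<in> (\<lambda>u. replicate (Suc d) c @ u) ` {w. length w = d}" by blast
  qed
  then have "card ?B \<le> card {w :: 'x list. length w = d}"
    using surj_card_le[OF fin] by blast
  then show ?thesis using card_lists_length_eq[of "UNIV :: 'x set" d] by simp
qed

text \<open>No failure occurs at even length, because a sparse word of length 2d has a leading run
  of at most d letters. The surplus r^d makes the induction work: two steps lose at most 2 r^d after
  doubling, and r + 2 <= r^2 for r >= 2 leaves the new surplus r^(d+1).\<close>

lemma card_sparse_words_even:
  fixes c :: "'x::finite"
  assumes "CARD('x) \<ge> 2"
  shows "CARD('x) ^ (2 * d) + CARD('x) ^ d \<le> 2 * card {w. length w = 2 * d \<and> sparse_word c w}"
    and "card {w. length w = Suc (2 * d) \<and> sparse_word c w} = CARD('x) * card {w. length w = 2 * d \<and> sparse_word c w}"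
proof -
  show odd: "card {w. length w = Suc (2 * d) \<and> sparse_word c w} = CARD('x) * card {w. length w = 2 * d \<and> sparse_word c w}" for d
  proof -
    have "{w. length w = 2 * d \<and> sparse_word c w \<and> 2 * d < 2 * lead_run c w} = {}"
      using sparse_word_bounds[of c] by fastforce
    then show ?thesis using card_sparse_words_Suc[of "2 * d" c] by (simp only: card.empty)
  qed
  show "CARD('x) ^ (2 * d) + CARD('x) ^ d \<le> 2 * card {w. length w = 2 * d \<and> sparse_word c w}"
  proof (induction d)
    case 0
    have "{w. length w = 2 * 0 \<and> sparse_word c w} = {[]}" by auto
    then show ?case by simp
  next
    case (Suc d)
    let ?r = "CARD('x)"
    have "?r * (?r * card {w. length w = 2 * d \<and> sparse_word c w})
        \<le> card {w. length w = 2 * Suc d \<and> sparse_word c w} + ?r ^ d"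
      using card_sparse_words_Suc[of "Suc (2 * d)" c] card_maximal_run_le[of d c] odd[of d] by simp
    moreover have "?r * ?r * (?r ^ (2 * d) + ?r ^ d) \<le> ?r * ?r * (2 * card {w. length w = 2 * d \<and> sparse_word c w})"
      using Suc by (intro mult_left_mono) auto
    moreover have "?r * ?r ^ d + 2 * ?r ^ d \<le> ?r * ?r * ?r ^ d"
    proof -
      have "?r + 2 \<le> ?r * ?r" using mult_le_mono1[OF assms, of ?r] assms by linarith
      then show ?thesis using mult_le_mono1[of "?r + 2" "?r * ?r" "?r ^ d"] by (simp add: algebra_simps)
    qed
    ultimately show ?case by (simp add: algebra_simps)
  qed
qed

lemma card_sparse_words_ge:
  fixes c :: "'x::finite"
  assumes "CARD('x) \<ge> 2"
  shows "CARD('x) ^ n \<le> 2 * card {w. length w = n \<and> sparse_word c w}"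
proof (cases "even n")
  case True
  then show ?thesis using card_sparse_words_even(1)[OF assms, of "n div 2" c] by simp
next
  case False
  then obtain d where d: "n = Suc (2 * d)" by (metis oddE Suc_eq_plus1)
  show ?thesis
    unfolding d card_sparse_words_even(2)[OF assms]
    using card_sparse_words_even(1)[OF assms, of d c] by (simp add: mult.left_commute)
qed

lemma sum_powers_le:
  assumes "(r::nat) \<ge> 2"
  shows "(\<Sum>i\<le>n. r ^ i) \<le> 2 * r ^ n"
proof (induction n)
  case (Suc n)
  have "2 * r ^ n \<le> r * r ^ n" using assms by simp
  moreover have "(\<Sum>i\<le>Suc n. r ^ i) = (\<Sum>i\<le>n. r ^ i) + r * r ^ n" by simp
  ultimately show ?case using Suc by (simp only: power_Suc)
qed simp

text \<open>At most 2 r^n words have length at most n, while at least half of the r^(n+2) >= 4 r^n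
  words of length n + 2 are sparse. The shift by 2 in the growth estimate comes from here.\<close>

lemma card_words_le_card_sparse_words:
  fixes c :: "'x::finite"
  assumes "CARD('x) \<ge> 2"
  shows "card {w :: 'x list. length w \<le> n} \<le> card {w. length w = n + 2 \<and> sparse_word c w}"
proof -
  have "card {w :: 'x list. length w \<le> n} \<le> 2 * CARD('x) ^ n"
    using card_lists_length_le[of "UNIV :: 'x set" n] sum_powers_le[OF assms, of n] by simp
  moreover have "4 * CARD('x) ^ n \<le> CARD('x) ^ (n + 2)"
    using mult_le_mono[OF assms assms] by (simp add: power_add power2_eq_square)
  ultimately show ?thesis using card_sparse_words_ge[OF assms, of "n + 2" c] by linarith
qed

section \<open>The action on blocks\<close>

text \<open>Index n lies in block \<open>lev n\<close>; block l > 0 hangs at the basis element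
  \<open>par l\<close> by the letter \<open>lab l\<close>. Here \<open>par_less\<close> yields
  triangularity, \<open>lev_par_less\<close> makes every letter other than c raise the level,
  \<open>ex_block\<close> lets every coordinate be read off some block, and
  \<open>finite_par\<close> keeps supports finite.\<close>

locale block_tree =
  fixes c :: "'x::finite" and a :: "nat \<Rightarrow> 'k::field"
    and lev :: "nat \<Rightarrow> nat" and par :: "nat \<Rightarrow> nat" and lab :: "nat \<Rightarrow> 'x"
  assumes inj_a: "inj a"
    and card_block: "card {n. lev n = l} = 2 ^ Suc l"
    and par_less: "0 < lev n \<Longrightarrow> par (lev n) < n"
    and lev_par_less: "0 < l \<Longrightarrow> lev (par l) < l"
    and lab_neq: "0 < l \<Longrightarrow> lab l \<noteq> c"
    and ex_block: "j \<noteq> c \<Longrightarrow> \<exists>l>0. par l = p \<and> lab l = j"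
    and finite_par: "finite {l. 0 < l \<and> par l \<le> b}"
begin

text \<open>The action in coordinates: c scales coordinate n by \<open>a n\<close>, and another
  letter j sends the basis element p to the sum of all blocks that hang at p by j. The form makes
  sense for arbitrary functions, finitely supported or not.\<close>

definition step :: "'x \<Rightarrow> (nat \<Rightarrow> 'k) \<Rightarrow> nat \<Rightarrow> 'k"
  where "step j v n = (if j = c then a n * v n
    else if 0 < lev n \<and> lab (lev n) = j then v (par (lev n)) else 0)"

definition root :: "nat \<Rightarrow> 'k"
  where "root n = (if lev n = 0 then 1 else 0)"

text \<open>Words are read backwards here: \<open>coords w\<close> are the coordinates of the product of the
  generator with the reversal of \<open>w\<close>.\<close>

abbreviation coords :: "'x list \<Rightarrow> nat \<Rightarrow> 'k"
  where "coords w \<equiv> foldr step w root"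

lemma finite_block: "finite {n. lev n = l}"
  by (rule card_ge_0_finite) (simp add: card_block)

lemma coords_replicate: "coords (replicate k c @ u) n = a n ^ k * coords u n"
  by (induction k) (auto simp: step_def)

text \<open>The letter c keeps the blocks, and each other letter leads to a block of higher
  level.\<close>

lemma others_le_lev: "coords w n \<noteq> 0 \<Longrightarrow> others c w \<le> lev n"
proof (induction w arbitrary: n)
  case (Cons x w)
  show ?case
  proof (cases "x = c")
    case True
    then show ?thesis using Cons by (auto simp: step_def)
  next
    case False
    then have *: "0 < lev n" "coords w (par (lev n)) \<noteq> 0"
      using Cons.prems by (auto simp: step_def[of x "coords w"] split: if_splits)
    then have "others c w \<le> lev (par (lev n))" using Cons.IH by blast
    then show ?thesis using lev_par_less[OF *(1)] False by simp
  qed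
qed simp

text \<open>The Vandermonde argument as a count of roots: the \<open>a n\<close> of one block are
  \<open>2 ^ Suc l\<close> distinct roots of a polynomial of smaller degree.\<close>

lemma poly_vanish_on_block:
  fixes p :: "'k poly"
  assumes "\<And>n. lev n = l \<Longrightarrow> poly p (a n) = 0" "\<And>k. coeff p k \<noteq> 0 \<Longrightarrow> k < 2 ^ Suc l"
  shows "p = 0"
proof (rule ccontr)
  assume p: "p \<noteq> 0"
  have "2 ^ Suc l = card (a ` {n. lev n = l})"
    using inj_a by (subst card_image) (auto simp: card_block inj_on_def)
  also have "\<dots> \<le> card {x. poly p x = 0}"
    using assms(1) poly_roots_finite[OF p] by (intro card_mono) auto
  also have "\<dots> \<le> degree p" by (rule card_poly_roots_bound[OF p])
  also have "\<dots> < 2 ^ Suc l" using assms(2) p by simp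
  finally show False by simp
qed

text \<open>A word that does not begin with c has the same coordinate at all indices of a block;
  this is the common value.\<close>

definition block_val :: "nat \<Rightarrow> 'x list \<Rightarrow> 'k"
  where "block_val l u = (case u of [] \<Rightarrow> if l = 0 then 1 else 0
    | j # w \<Rightarrow> if 0 < l \<and> lab l = j then coords w (par l) else 0)"

lemma coords_eq_block_val: "u = [] \<or> hd u \<noteq> c \<Longrightarrow> coords u n = block_val (lev n) u"
  by (cases u) (auto simp: block_val_def root_def step_def)

text \<open>On a block the coordinates of a combination of words are the values of a polynomial at the
  \<open>a n\<close>, whose \<open>k\<close>-th coefficient collects the words with exactly \<open>k\<close> leading letters \<open>c\<close>; sparseness
  makes its degree smaller than the size of the block.\<close>

lemma sum_same_run_eq_0:
  assumes sparse: "\<And>w. f w \<noteq> 0 \<Longrightarrow> sparse_word c w \<and> length w \<le> L"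
    and zero: "\<And>n. (\<Sum>w | length w \<le> L. f w * coords w n) = 0"
  shows "(\<Sum>u | length u \<le> L \<and> (u = [] \<or> hd u \<noteq> c). f (replicate k c @ u) * block_val l u) = 0"
proof -
  define U where "U = {u. length u \<le> L \<and> (u = [] \<or> hd u \<noteq> c)}"
  define S where "S k = (\<Sum>u\<in>U. f (replicate k c @ u) * block_val l u)" for k
  define g where "g = (\<lambda>(k, u). replicate k c @ u)"
  have fin_W: "finite {w :: 'x list. length w \<le> L}"
    using finite_lists_length_le[of "UNIV :: 'x set" L] by simp
  then have fin_U: "finite U" by (rule rev_finite_subset) (auto simp: U_def)
  have inj_g: "inj_on g ({..L} \<times> U)"
  proof (rule inj_onI, clarify)
    fix k u k' u' assume "u \<in> U" "u' \<in> U" and eq: "g (k, u) = g (k', u')"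
    then have "k = k'"
      using lead_run_replicate_append[of u c k] lead_run_replicate_append[of u' c k'] by (auto simp: U_def g_def)
    then show "k = k' \<and> u = u'" using eq by (simp add: g_def)
  qed
  have sub: "{w. length w \<le> L} \<subseteq> g ` ({..L} \<times> U)"
  proof
    fix w :: "'x list" assume w: "w \<in> {w. length w \<le> L}"
    let ?u = "dropWhile (\<lambda>x. x = c) w"
    have "lead_run c w \<le> length w" by (simp add: lead_run_def length_takeWhile_le)
    moreover have "?u \<in> U" using w hd_dropWhile[of "\<lambda>x. x = c" w] length_dropWhile_le[of "\<lambda>x. x = c" w]
      by (auto simp: U_def simp del: length_dropWhile_le)
    ultimately show "w \<in> g ` ({..L} \<times> U)"
      using w replicate_lead_run[of w c] by (intro image_eqI[of _ _ "(lead_run c w, ?u)"]) (auto simp: g_def)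
  qed
  have S_0: "S k = 0" if "L < k" for k
  proof -
    have "f (replicate k c @ u) = 0" for u
      using sparse[of "replicate k c @ u"] that by force
    then show ?thesis by (simp add: S_def)
  qed
  \<comment> \<open>A nonzero term belongs to a word u that reaches block l, hence has at most l
    other letters; \<open>lead_run_less\<close> then bounds the run in front of u.\<close>
  have S_small: "k < 2 ^ Suc l" if "S k \<noteq> 0" for k
  proof -
    obtain u where u: "u \<in> U" "f (replicate k c @ u) * block_val l u \<noteq> 0"
      using \<open>S k \<noteq> 0\<close> unfolding S_def by (rule sum.not_neutral_contains_not_neutral)
    have "{n. lev n = l} \<noteq> {}" using card_block[of l] by (metis card.empty power_not_zero zero_neq_numeral)
    then obtain n where n: "lev n = l" by auto
    have u': "u = [] \<or> hd u \<noteq> c" using u(1) by (simp add: U_def)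
    have "coords u n \<noteq> 0" using u(2) n coords_eq_block_val[OF u'] by auto
    then have le: "others c u \<le> l" using others_le_lev n by blast
    have "sparse_word c (replicate k c @ u)" using sparse u(2) by auto
    then have "k < 2 ^ Suc (others c u)"
      using lead_run_less[of c "replicate k c @ u"] lead_run_replicate_append[OF u'] by simp
    also have "\<dots> \<le> 2 ^ Suc l" using le by (intro power_increasing) auto
    finally show ?thesis .
  qed
  define p where "p = (\<Sum>k\<le>L. monom (S k) k)"
  have coeff_p: "coeff p k = S k" for k
    using S_0[of k] by (auto simp: p_def coeff_sum sum.If_cases[where P = "\<lambda>i. i = k"] if_distrib)
  have "poly p (a n) = 0" if "lev n = l" for n
  proof -
    have "poly p (a n) = (\<Sum>k\<le>L. \<Sum>u\<in>U. f (replicate k c @ u) * block_val l u * a n ^ k)"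
      by (simp add: p_def poly_sum poly_monom S_def sum_distrib_right)
    also have "\<dots> = (\<Sum>(k, u)\<in>{..L} \<times> U. f (replicate k c @ u) * block_val l u * a n ^ k)"
      by (rule sum.cartesian_product)
    also have "\<dots> = (\<Sum>x\<in>{..L} \<times> U. f (g x) * coords (g x) n)"
    proof (rule sum.cong[OF refl], clarify)
      fix k u assume "u \<in> U"
      then have "coords u n = block_val l u" using coords_eq_block_val[of u n] that by (simp add: U_def)
      then show "f (replicate k c @ u) * block_val l u * a n ^ k = f (g (k, u)) * coords (g (k, u)) n"
        unfolding g_def prod.case coords_replicate by simp
    qed
    also have "\<dots> = (\<Sum>w\<in>g ` ({..L} \<times> U). f w * coords w n)"
      by (simp add: sum.reindex[OF inj_g])
    \<comment> \<open>The image of \<open>g\<close> also contains words longer than L; f vanishes on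
      them.\<close>
    also have "\<dots> = (\<Sum>w | length w \<le> L. f w * coords w n)"
      by (rule sum.mono_neutral_right) (use fin_U sub sparse in auto)
    finally show ?thesis using zero by simp
  qed
  then have "p = 0" using S_small coeff_p by (intro poly_vanish_on_block[of l]) auto
  then have "S k = 0" using coeff_p[of k] by simp
  then show ?thesis by (simp add: S_def U_def)
qed

text \<open>After fixing the leading run k, block 0 isolates the word c^k, since no other remainder
  u is nonzero there. A block hanging at p by j isolates the words c^k j v and shows the p-th
  coordinate of v. As every p has such a block, the coefficients of these words give a vanishing
  combination of the shorter words v, which are sparse as suffixes of sparse words.\<close>

theorem coords_independent:
  assumes "\<And>w. f w \<noteq> 0 \<Longrightarrow> sparse_word c w \<and> length w \<le> L"
    and "\<And>n. (\<Sum>w | length w \<le> L. f w * coords w n) = 0"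
  shows "f w = 0"
  using assms
proof (induction L arbitrary: f w rule: less_induct)
  case (less L)
  show ?case
  proof (rule ccontr)
    assume "f w \<noteq> 0"
    then have len: "length w \<le> L" using less.prems(1) by blast
    define k u where "k = lead_run c w" and "u = dropWhile (\<lambda>x. x = c) w"
    have w: "w = replicate k c @ u" unfolding k_def u_def by (rule replicate_lead_run)
    define U where "U = {u :: 'x list. length u \<le> L \<and> (u = [] \<or> hd u \<noteq> c)}"
    have "finite {w :: 'x list. length w \<le> L}"
      using finite_lists_length_le[of "UNIV :: 'x set" L] by simp
    then have fin_U: "finite U" by (rule rev_finite_subset) (auto simp: U_def)
    have zero: "(\<Sum>u\<in>U. f (replicate k c @ u) * block_val l u) = 0" for l
      unfolding U_def by (rule sum_same_run_eq_0[OF less.prems])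
    show False
    proof (cases u)
      case Nil
      have "(\<Sum>u\<in>U. f (replicate k c @ u) * block_val 0 u) = (\<Sum>u\<in>U. if u = [] then f (replicate k c @ u) else 0)"
        by (rule sum.cong) (auto simp: block_val_def split: list.splits)
      also have "\<dots> = f w" using fin_U by (simp add: sum.delta w Nil U_def)
      finally show False using zero \<open>f w \<noteq> 0\<close> by simp
    next
      case (Cons j w')
      have j: "j \<noteq> c" using Cons hd_dropWhile[of "\<lambda>x. x = c" w] by (auto simp: u_def)
      have L: "0 < L" using len w Cons by simp
      define f' where "f' v = f (replicate k c @ j # v)" for v
      have "f' w' = 0"
      proof (rule less.IH[of "L - 1"])
        show "L - 1 < L" using L by simp
        show "sparse_word c v \<and> length v \<le> L - 1" if "f' v \<noteq> 0" for v
          using less.prems(1)[of "replicate k c @ j # v"] sparse_word_append[of c "replicate k c @ [j]" v] that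
          by (auto simp: f'_def)
        fix p
        obtain l where l: "0 < l" "par l = p" "lab l = j" using ex_block[OF j] by blast
        have "(\<Sum>u\<in>U. f (replicate k c @ u) * block_val l u)
            = (\<Sum>u\<in>(#) j ` {v. length v \<le> L - 1}. f (replicate k c @ u) * block_val l u)"
          by (rule sum.mono_neutral_right)
            (use fin_U l j L in \<open>auto simp: U_def block_val_def image_iff split: list.splits\<close>)
        also have "\<dots> = (\<Sum>v | length v \<le> L - 1. f' v * coords v p)"
          by (subst sum.reindex) (auto simp: f'_def block_val_def l)
        finally show "(\<Sum>v | length v \<le> L - 1. f' v * coords v p) = 0" using zero by simp
      qed
      then show False using \<open>f w \<noteq> 0\<close> by (simp add: f'_def w Cons)
    qed
  qed
qed

end

section \<open>Submodules and factor modules\<close>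

lemma is_submodule_image_factor:
  assumes M: "right_module M" and N: "is_submodule N M" and W: "is_submodule W M"
  shows "is_submodule ((\<lambda>x. N +>\<^bsub>M\<^esub> x) ` W) (factor_module M N)"
proof (rule is_submoduleI[OF right_module_factor_module[OF M N]])
  note W' = is_submoduleD[OF M W]
  show "(\<lambda>x. N +>\<^bsub>M\<^esub> x) ` W \<subseteq> carrier (factor_module M N)"
    using W'(1) by (auto simp: carrier_factor_module[OF M N])
  show "\<zero>\<^bsub>factor_module M N\<^esub> \<in> (\<lambda>x. N +>\<^bsub>M\<^esub> x) ` W"
    using W'(2) by (simp add: zero_factor_module[OF M N])
  show "X \<oplus>\<^bsub>factor_module M N\<^esub> Y \<in> (\<lambda>x. N +>\<^bsub>M\<^esub> x) ` W"
    if XY: "X \<in> (\<lambda>x. N +>\<^bsub>M\<^esub> x) ` W" "Y \<in> (\<lambda>x. N +>\<^bsub>M\<^esub> x) ` W" for X Y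
  proof -
    obtain x y where xy: "x \<in> W" "y \<in> W" "X = N +>\<^bsub>M\<^esub> x" "Y = N +>\<^bsub>M\<^esub> y" using XY by blast
    then show ?thesis using W'(1) W'(3)[of x y] coset_add[OF M N, of x y] by auto
  qed
  show "u \<odot>\<^bsub>factor_module M N\<^esub> X \<in> (\<lambda>x. N +>\<^bsub>M\<^esub> x) ` W"
    if "X \<in> (\<lambda>x. N +>\<^bsub>M\<^esub> x) ` W" for X u
    using that W'(1,5) coset_act[OF M N] by (auto simp: subset_eq)
qed

text \<open>The vectors whose coset lies in the span of the cosets of A form a subspace containing A
  and N, hence everything.\<close>

lemma fin_dim_factor_module:
  assumes M: "right_module M" and N: "is_submodule N M"
    and A: "finite A" "A \<subseteq> carrier M" and span: "carrier M \<subseteq> lin_span M (A \<union> N)"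
  shows "fin_dim (factor_module M N)"
proof -
  interpret right_module M by fact
  let ?L = "factor_module M N" and ?\<pi> = "\<lambda>x. N +>\<^bsub>M\<^esub> x"
  note L = right_module_factor_module[OF M N] and N' = is_submoduleD[OF M N]
  have piA: "?\<pi> ` A \<subseteq> carrier ?L" using A by (auto simp: carrier_factor_module[OF M N])
  note W = linear_subspace_lin_span[OF L piA] lin_span_superset[OF L piA]
  let ?V = "{x \<in> carrier M. ?\<pi> x \<in> lin_span ?L (?\<pi> ` A)}"
  have "linear_subspace M ?V"
    using W(1) coset_add[OF M N] coset_act[OF M N] zero_factor_module[OF M N]
    by (auto simp: linear_subspace_def act_closed simp flip: coset_add[OF M N] coset_act[OF M N])
  moreover have "?\<pi> x = \<zero>\<^bsub>?L\<^esub>" if "x \<in> N" for x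
    using that N'(1) coset_eq_zero_iff[OF M N, of x] by blast
  then have "A \<union> N \<subseteq> ?V"
    using A N'(1) W by (auto simp: linear_subspace_def)
  ultimately have "carrier M \<subseteq> ?V" using lin_span_minimal[OF M] span by blast
  then have "carrier ?L \<subseteq> lin_span ?L (?\<pi> ` A)" by (auto simp: carrier_factor_module[OF M N])
  then show ?thesis using A(1) piA by (auto simp: fin_dim_iff[OF L])
qed

text \<open>The map \<open>co\<close> identifies the module with the finitely supported functions
  under \<open>step\<close>. Keeping the carrier abstract separates the arguments from the encoding
  that the type of elements in the theorem demands.\<close>

locale tree_module = block_tree c a lev par lab + right_module M
  for c :: "'x::finite" and a :: "nat \<Rightarrow> 'k::field" and lev par lab
    and M :: "(('k, 'x) free_alg, 'm, 'z) module_scheme" (structure) +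
  fixes co :: "'m \<Rightarrow> nat \<Rightarrow> 'k"
  assumes inj_co: "inj_on co (carrier M)"
    and co_image: "co ` carrier M = {v. finite {n. v n \<noteq> 0}}"
    and co_add: "x \<in> carrier M \<Longrightarrow> y \<in> carrier M \<Longrightarrow> co (x \<oplus> y) n = co x n + co y n"
    and co_const: "x \<in> carrier M \<Longrightarrow> co (const s \<odot> x) n = s * co x n"
    and co_var: "x \<in> carrier M \<Longrightarrow> co (var j \<odot> x) n = step j (co x) n"
begin

lemmas M = right_module_axioms

definition elem :: "(nat \<Rightarrow> 'k) \<Rightarrow> 'm"
  where "elem = inv_into (carrier M) co"

abbreviation e :: "nat \<Rightarrow> 'm"
  where "e n \<equiv> elem (\<lambda>k. if k = n then 1 else 0)"

lemma elem:
  assumes "finite {n. v n \<noteq> 0}"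
  shows "elem v \<in> carrier M" "co (elem v) = v"
proof -
  have "v \<in> co ` carrier M" using assms by (simp add: co_image)
  then show "elem v \<in> carrier M" "co (elem v) = v"
    by (simp_all add: elem_def inv_into_into f_inv_into_f)
qed

lemma e [simp]: "e n \<in> carrier M" "co (e n) k = (if k = n then 1 else 0)"
  using elem[of "\<lambda>k. if k = n then 1 else 0"] by simp_all

lemma co_eqI: "x \<in> carrier M \<Longrightarrow> y \<in> carrier M \<Longrightarrow> (\<And>n. co x n = co y n) \<Longrightarrow> x = y"
  using inj_co by (auto simp: inj_on_def fun_eq_iff)

lemma finite_support: "x \<in> carrier M \<Longrightarrow> finite {n. co x n \<noteq> 0}"
  using co_image by auto

lemma functional_co: "linear_functional M (\<lambda>x. co x n)"
  by (simp add: linear_functional_def co_add co_const)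

lemma co_zero [simp]: "co \<zero> n = 0"
  using linear_functional_zero[OF M functional_co] .

lemma co_uminus [simp]: "x \<in> carrier M \<Longrightarrow> co (\<ominus> x) n = - co x n"
  using co_const[of x "-1" n] minus_act[of x 1] by (simp add: act_one)

lemma co_diff: "x \<in> carrier M \<Longrightarrow> y \<in> carrier M \<Longrightarrow> co (x \<ominus> y) n = co x n - co y n"
  by (simp add: a_minus_def co_add)

text \<open>Basis elements are peeled off one at a time, by induction on the size of the
  support.\<close>

lemma mem_linear_subspace:
  assumes W: "linear_subspace M W" and "x \<in> carrier M" "\<And>n. co x n \<noteq> 0 \<Longrightarrow> e n \<in> W"
  shows "x \<in> W"
  using assms(2,3)
proof (induction "card {n. co x n \<noteq> 0}" arbitrary: x rule: less_induct)
  case less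
  show ?case
  proof (cases "\<exists>n. co x n \<noteq> 0")
    case False
    then have "x = \<zero>" using less.prems by (intro co_eqI) auto
    then show ?thesis using W by (simp add: linear_subspace_def)
  next
    case True
    then obtain n where n: "co x n \<noteq> 0" by blast
    define y where "y = x \<oplus> const (- co x n) \<odot> e n"
    have y: "y \<in> carrier M" by (simp add: y_def less.prems act_closed)
    have co_y: "co y k = (if k = n then 0 else co x k)" for k
      by (simp add: y_def co_add co_const act_closed less.prems del: const_simps)
    have "card {k. co y k \<noteq> 0} < card {k. co x k \<noteq> 0}"
      using n by (intro psubset_card_mono finite_support less.prems) (auto simp: co_y)
    then have "y \<in> W" by (rule less.hyps) (auto simp: y co_y less.prems split: if_splits)
    moreover have "const (co x n) \<odot> e n \<in> W"
      using W less.prems(2)[OF n] by (simp add: linear_subspace_def)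
    moreover have "x = y \<oplus> const (co x n) \<odot> e n"
      by (rule co_eqI) (simp_all add: less.prems y act_closed co_add co_const co_y)
    ultimately show ?thesis using W by (metis linear_subspace_def)
  qed
qed

lemma linear_subspace_supported: "linear_subspace M {x \<in> carrier M. \<forall>n. co x n \<noteq> 0 \<longrightarrow> n \<in> S}"
  by (auto simp: linear_subspace_def co_add co_const act_closed) force+

lemma lin_span_e: "lin_span M (e ` S) = {x \<in> carrier M. \<forall>n. co x n \<noteq> 0 \<longrightarrow> n \<in> S}"
proof
  show "lin_span M (e ` S) \<subseteq> {x \<in> carrier M. \<forall>n. co x n \<noteq> 0 \<longrightarrow> n \<in> S}"
    by (rule lin_span_minimal[OF M linear_subspace_supported]) (auto split: if_splits)
  have sub: "e ` S \<subseteq> carrier M" by auto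
  show "{x \<in> carrier M. \<forall>n. co x n \<noteq> 0 \<longrightarrow> n \<in> S} \<subseteq> lin_span M (e ` S)"
    using mem_linear_subspace[OF linear_subspace_lin_span[OF M sub]] lin_span_superset[OF M sub] by blast
qed

text \<open>The letter \<open>c\<close> acts diagonally with distinct eigenvalues, so a submodule contains every
  basis element that occurs in one of its members.\<close>

lemma e_mem_submodule:
  assumes N: "is_submodule N M" and "x \<in> N" "co x n \<noteq> 0"
  shows "e n \<in> N"
  using assms(2,3)
proof (induction "card {n. co x n \<noteq> 0}" arbitrary: x rule: less_induct)
  case less
  note N' = is_submoduleD[OF M N]
  have x: "x \<in> carrier M" using less.prems N' by blast
  show ?case
  proof (cases "\<exists>m. m \<noteq> n \<and> co x m \<noteq> 0")
    case False
    have "e n = const (inverse (co x n)) \<odot> x"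
      by (rule co_eqI) (use False x less.prems in \<open>auto simp: co_const act_closed\<close>)
    then show ?thesis using N' less.prems by metis
  next
    case True
    then obtain m where m: "m \<noteq> n" "co x m \<noteq> 0" by blast
    \<comment> \<open>This factor kills coordinate m and multiplies every other one by a nonzero
      scalar, so the support shrinks and still contains n.\<close>
    define y where "y = (var c - const (a m)) \<odot> x"
    have co_y: "co y k = (a k - a m) * co x k" for k
      by (simp add: y_def diff_act x co_diff act_closed co_var co_const step_def algebra_simps)
    have "card {k. co y k \<noteq> 0} < card {k. co x k \<noteq> 0}"
      using m by (intro psubset_card_mono finite_support x) (auto simp: co_y)
    moreover have "y \<in> N" using N' less.prems by (simp add: y_def)
    moreover have "co y n \<noteq> 0" using m less.prems inj_a by (auto simp: co_y inj_def)
    ultimately show ?thesis by (rule less.hyps)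
  qed
qed

section \<open>The filtration by tails: triangularity, residual finiteness, products of the
  \<open>Delta\<close>\<close>

definition tail :: "nat \<Rightarrow> 'm set"
  where "tail i = {x \<in> carrier M. \<forall>n<i. co x n = 0}"

lemma tail_eq: "tail i = lin_span M (e ` {i..})"
  unfolding lin_span_e by (auto simp: tail_def not_less intro: leI)

text \<open>Coordinate n of a product with a letter depends only on coordinate n or on one at a
  smaller index, by \<open>par_less\<close>.\<close>

lemma is_submodule_tail: "is_submodule (tail i) M"
proof (rule linear_subspace_imp_submodule[OF M])
  show "linear_subspace M (tail i)"
    by (simp add: tail_def linear_subspace_def co_add co_const act_closed)
  show "var j \<odot> x \<in> tail i" if "x \<in> tail i" for x j
    using that by (auto simp: tail_def act_closed co_var step_def intro: less_trans[OF par_less])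
qed

lemma tail_0: "tail 0 = carrier M"
  by (auto simp: tail_def)

lemma triangular_M: "triangular M"
  unfolding triangular_def
proof (intro exI conjI allI)
  interpret vs: vectorspace class_ring "vs_of M" by (rule vectorspace_vs_of[OF M])
  have indep: "\<forall>i\<in>J. s i = 0" if "finite J" "\<forall>n. (\<Sum>i\<in>J. s i * co (e i) n) = 0" for J s
  proof
    fix i assume "i \<in> J"
    have "(\<Sum>k\<in>J. s k * co (e k) i) = (\<Sum>k\<in>J. if k = i then s k else 0)"
      by (rule sum.cong) auto
    then show "s i = 0" using that \<open>i \<in> J\<close> by (simp add: sum.delta)
  qed
  have "range e \<subseteq> carrier M" by auto
  note fam = lin_indpt_familyI[OF M this functional_co indep]
  show "inj e" by (rule fam(1))
  show "lin_basis M (range e)"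
    using fam(2) lin_span_e[of UNIV] by (auto simp: vs.basis_def)
  show "u \<odot> e i \<in> lin_span M (e ` {i..})" for i u
    using is_submoduleD(5)[OF M is_submodule_tail, of "e i" i u]
    by (simp add: tail_def flip: tail_eq)
qed

lemma span_tail: "carrier M \<subseteq> lin_span M (e ` {..<i} \<union> tail i)"
proof
  have sub: "e ` {..<i} \<union> tail i \<subseteq> carrier M" by (auto simp: tail_def)
  fix x assume "x \<in> carrier M"
  then show "x \<in> lin_span M (e ` {..<i} \<union> tail i)"
  proof (rule mem_linear_subspace[OF linear_subspace_lin_span[OF M sub]])
    fix n
    have "e n \<in> e ` {..<i} \<union> tail i" by (auto simp: tail_def)
    then show "e n \<in> lin_span M (e ` {..<i} \<union> tail i)" using lin_span_superset[OF M sub] by blast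
  qed
qed

text \<open>Subtracting an element of \<open>tail (Suc n)\<close> does not change coordinate n. If
  that coordinate of x is nonzero, \<open>e_mem_submodule\<close> therefore applies to the
  difference, and N contains every basis element occurring in x.\<close>

lemma mem_if_mem_plus_tails:
  assumes N: "is_submodule N M" and x: "x \<in> carrier M"
    and tails: "\<And>i. \<exists>t\<in>tail i. x \<ominus> t \<in> N"
  shows "x \<in> N"
proof (rule mem_linear_subspace[OF submodule_imp_linear_subspace[OF M N] x])
  fix n assume n: "co x n \<noteq> 0"
  obtain t where t: "t \<in> tail (Suc n)" "x \<ominus> t \<in> N" using tails by blast
  then have "co (x \<ominus> t) n \<noteq> 0" using n x by (simp add: co_diff tail_def)
  then show "e n \<in> N" by (rule e_mem_submodule[OF N t(2)])
qed

lemma coset_tails_eq_zero: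
  assumes N: "is_submodule N M" and X: "X \<in> carrier (factor_module M N)"
    and tails: "\<And>i. X \<in> (\<lambda>x. N +>\<^bsub>M\<^esub> x) ` tail i"
  shows "X = \<zero>\<^bsub>factor_module M N\<^esub>"
proof -
  obtain x where x: "x \<in> carrier M" "X = N +>\<^bsub>M\<^esub> x" using X by (auto simp: carrier_factor_module[OF M N])
  have "x \<in> N"
  proof (rule mem_if_mem_plus_tails[OF N x(1)])
    fix i
    obtain t where t: "t \<in> tail i" "X = N +>\<^bsub>M\<^esub> t" using tails by blast
    then show "\<exists>t\<in>tail i. x \<ominus> t \<in> N"
      using coset_eq_iff[OF M N, of x t] x by (auto simp: tail_def)
  qed
  then show ?thesis using x coset_eq_zero_iff[OF M N] by simp
qed

lemma residually_finite_factor: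
  assumes N: "is_submodule N M"
  shows "residually_finite (factor_module M N)"
  unfolding residually_finite_def
proof (intro ballI impI)
  let ?L = "factor_module M N" and ?\<pi> = "\<lambda>x. N +>\<^bsub>M\<^esub> x"
  note L = right_module_factor_module[OF M N]
  fix X assume X: "X \<in> carrier ?L" "X \<noteq> \<zero>\<^bsub>?L\<^esub>"
  then obtain i where i: "X \<notin> ?\<pi> ` tail i" using coset_tails_eq_zero[OF N] by blast
  have T: "is_submodule (?\<pi> ` tail i) ?L" by (rule is_submodule_image_factor[OF M N is_submodule_tail])
  let ?A = "?\<pi> ` e ` {..<i} \<union> ?\<pi> ` tail i"
  have A: "?A \<subseteq> carrier ?L" by (auto simp: carrier_factor_module[OF M N] tail_def)
  \<comment> \<open>The spanning statement is proved in M, for the preimage of the span, and then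
    pushed to the factor module.\<close>
  have "linear_subspace M {x \<in> carrier M. ?\<pi> x \<in> lin_span ?L ?A}"
    using linear_subspace_lin_span[OF L A] zero_factor_module[OF M N]
    by (auto simp: linear_subspace_def act_closed simp flip: coset_add[OF M N] coset_act[OF M N])
  moreover have "e ` {..<i} \<union> tail i \<subseteq> {x \<in> carrier M. ?\<pi> x \<in> lin_span ?L ?A}"
    using lin_span_superset[OF L A] is_submoduleD(1)[OF M is_submodule_tail[of i]] by auto
  ultimately have "carrier M \<subseteq> {x \<in> carrier M. ?\<pi> x \<in> lin_span ?L ?A}"
    using lin_span_minimal[OF M] span_tail[of i] by blast
  then have "carrier ?L \<subseteq> lin_span ?L ?A" by (auto simp: carrier_factor_module[OF M N])
  then have "fin_dim (factor_module ?L (?\<pi> ` tail i))"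
    using A by (intro fin_dim_factor_module[OF L T, of "?\<pi> ` e ` {..<i}"]) auto
  then show "\<exists>W. is_submodule W ?L \<and> X \<notin> W \<and> fin_dim (factor_module ?L W)"
    using T i by blast
qed

text \<open>Treated apart from the factor modules, because M is only isomorphic, not equal, to its
  factor by zero.\<close>

lemma residually_finite_M: "residually_finite M"
  unfolding residually_finite_def
proof (intro ballI impI)
  fix x assume x: "x \<in> carrier M" "x \<noteq> \<zero>"
  then obtain n where n: "co x n \<noteq> 0" using co_eqI[of x \<zero>] by auto
  have "fin_dim (factor_module M (tail (Suc n)))"
    by (rule fin_dim_factor_module[OF M is_submodule_tail _ _ span_tail]) auto
  moreover have "x \<notin> tail (Suc n)" using n by (auto simp: tail_def)
  ultimately show "\<exists>N. is_submodule N M \<and> x \<notin> N \<and> fin_dim (factor_module M N)"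
    using is_submodule_tail by blast
qed

text \<open>Chosen so that the i-th ideal moves \<open>tail (i - 1)\<close> into
  \<open>tail i\<close>: the scalars are the diagonal entries at basis element i - 1. The shift
  arises because the ideals are numbered from 1 and the basis from 0.\<close>

definition \<alpha> :: "'x \<Rightarrow> nat \<Rightarrow> 'k"
  where "\<alpha> j i = (if j = c then a (i - 1) else 0)"

text \<open>The algebra elements that move \<open>tail i\<close> into \<open>tail (Suc i)\<close>
  form a right ideal, so the generators suffice; on them coordinate i vanishes by the choice of
  \<open>\<alpha>\<close>.\<close>

lemma Delta_act_tail:
  assumes "x \<in> tail i" "u \<in> Delta \<alpha> (Suc i)"
  shows "u \<odot> x \<in> tail (Suc i)"
proof -
  let ?D = "{u. \<forall>x\<in>tail i. u \<odot> x \<in> tail (Suc i)}"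
  have T: "x \<in> carrier M" if "x \<in> tail i" for x i using that by (simp add: tail_def)
  have "is_submodule ?D regular_module"
  proof (rule is_submoduleI[OF right_module_regular])
    show "\<zero>\<^bsub>regular_module\<^esub> \<in> ?D"
      using T is_submoduleD[OF M is_submodule_tail] by (auto simp: zero_act)
  qed (use is_submoduleD[OF M is_submodule_tail] T in \<open>auto simp: act_add_right act_assoc\<close>)
  moreover have "var j - const (\<alpha> j (Suc i)) \<in> ?D" for j
  proof (clarify)
    fix x assume x: "x \<in> tail i"
    have "step j (co x) n - \<alpha> j (Suc i) * co x n = 0" if "n < Suc i" for n
      using x that par_less[of n] by (auto simp: step_def \<alpha>_def tail_def less_Suc_eq)
    then show "(var j - const (\<alpha> j (Suc i))) \<odot> x \<in> tail (Suc i)"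
      using x by (simp add: tail_def diff_act co_diff act_closed co_var co_const)
  qed
  ultimately have "Delta \<alpha> (Suc i) \<subseteq> ?D"
    unfolding Delta_def by (intro generated_submodule_subset) auto
  then show ?thesis using assms by blast
qed

text \<open>Zero is carried along so that the intersection is exactly the zero submodule.\<close>

lemma Delta_product_factor:
  assumes N: "is_submodule N M"
  shows "Delta_product (factor_module M N) \<alpha> i \<subseteq> (\<lambda>x. N +>\<^bsub>M\<^esub> x) ` tail i
    \<and> \<zero>\<^bsub>factor_module M N\<^esub> \<in> Delta_product (factor_module M N) \<alpha> i"
proof (induction i)
  case 0
  show ?case using is_submoduleD(2)[OF M is_submodule_tail[of 0]]
    by (simp add: carrier_factor_module[OF M N] zero_factor_module[OF M N] tail_0)
next
  case (Suc i)
  let ?L = "factor_module M N" and ?\<pi> = "\<lambda>x. N +>\<^bsub>M\<^esub> x"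
  note L = right_module_factor_module[OF M N]
  let ?S = "{u \<odot>\<^bsub>?L\<^esub> X | X u. X \<in> Delta_product ?L \<alpha> i \<and> u \<in> Delta \<alpha> (Suc i)}"
  have sub: "linear_subspace ?L (?\<pi> ` tail (Suc i))"
    by (rule submodule_imp_linear_subspace[OF L is_submodule_image_factor[OF M N is_submodule_tail]])
  have S: "?S \<subseteq> ?\<pi> ` tail (Suc i)"
  proof clarify
    fix X u assume "X \<in> Delta_product ?L \<alpha> i" and u: "u \<in> Delta \<alpha> (Suc i)"
    then obtain x where x: "x \<in> tail i" "X = ?\<pi> x" using Suc by blast
    then have "u \<odot>\<^bsub>?L\<^esub> X = ?\<pi> (u \<odot> x)" using coset_act[OF M N] by (simp add: tail_def)
    then show "u \<odot>\<^bsub>?L\<^esub> X \<in> ?\<pi> ` tail (Suc i)" using Delta_act_tail[OF x(1) u] by simp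
  qed
  then have "?S \<subseteq> carrier ?L" using sub by (auto simp: linear_subspace_def)
  from linear_subspace_lin_span[OF L this] have "\<zero>\<^bsub>?L\<^esub> \<in> lin_span ?L ?S"
    by (simp add: linear_subspace_def)
  moreover have "lin_span ?L ?S \<subseteq> ?\<pi> ` tail (Suc i)" by (rule lin_span_minimal[OF L sub S])
  ultimately show ?case by (simp add: act_span_def)
qed

lemma Inter_Delta_product:
  assumes N: "is_submodule N M"
  shows "(\<Inter>i\<in>{1..}. Delta_product (factor_module M N) \<alpha> i) = {\<zero>\<^bsub>factor_module M N\<^esub>}"
proof -
  let ?L = "factor_module M N"
  have "X = \<zero>\<^bsub>?L\<^esub>" if X: "\<forall>i\<in>{1..}. X \<in> Delta_product ?L \<alpha> i" for X
  proof (rule coset_tails_eq_zero[OF N])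
    \<comment> \<open>The intersection starts at index 1; membership for index 0 follows because the
      tails decrease.\<close>
    have "X \<in> (\<lambda>x. N +>\<^bsub>M\<^esub> x) ` tail (Suc i)" for i
      using X Delta_product_factor[OF N, of "Suc i"] by fastforce
    moreover have "tail (Suc i) \<subseteq> tail i" for i by (auto simp: tail_def)
    ultimately show "X \<in> (\<lambda>x. N +>\<^bsub>M\<^esub> x) ` tail i" for i by blast
    from this[of 0] show "X \<in> carrier ?L" by (simp add: carrier_factor_module[OF M N] tail_0)
  qed
  moreover have "\<zero>\<^bsub>?L\<^esub> \<in> Delta_product ?L \<alpha> i" for i using Delta_product_factor[OF N] by blast
  ultimately show ?thesis by blast
qed

end

section \<open>Simple sections and the cyclic generator\<close>

context tree_module
begin

text \<open>N and P are spanned by basis elements; let e n be the first one in N but not in P. The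
  image of \<open>N \<inter> tail (Suc n)\<close> is a submodule missing e n, so it is zero by
  simplicity. Thus all later basis elements of N lie in P, the earlier ones do by minimality, and N
  / P is spanned by the image of e n.\<close>

lemma one_dimensional_simple_section:
  fixes Q :: "(('k, 'x) free_alg, 'q, 'y) module_scheme"
  assumes "is_section Q M" "simple_module Q"
  shows "one_dimensional Q"
proof -
  have Q: "right_module Q" and Q_ne: "carrier Q \<noteq> {\<zero>\<^bsub>Q\<^esub>}"
    and Q_simple: "\<And>W. is_submodule W Q \<Longrightarrow> W = {\<zero>\<^bsub>Q\<^esub>} \<or> W = carrier Q"
    using assms(2) by (auto simp: simple_module_def)
  interpret Q: right_module Q by (rule Q)
  obtain N P f where N: "is_submodule N M" and P: "is_submodule P M" and "P \<subseteq> N"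
    and bij: "bij_betw f (carrier Q) (carrier (factor_module (M\<lparr>carrier := N\<rparr>) P))"
    and f_add: "\<And>x y. x \<in> carrier Q \<Longrightarrow> y \<in> carrier Q \<Longrightarrow>
      f (x \<oplus>\<^bsub>Q\<^esub> y) = f x \<oplus>\<^bsub>factor_module (M\<lparr>carrier := N\<rparr>) P\<^esub> f y"
    and f_act: "\<And>x u. x \<in> carrier Q \<Longrightarrow> f (u \<odot>\<^bsub>Q\<^esub> x) = u \<odot>\<^bsub>factor_module (M\<lparr>carrier := N\<rparr>) P\<^esub> f x"
    using assms(1) unfolding is_section_def isomorphic_modules_def by blast
  define NM where "NM = M\<lparr>carrier := N\<rparr>"
  define L where "L = factor_module NM P"
  have NM: "right_module NM" unfolding NM_def by (rule right_module_carrier_update[OF M N])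
  note N' = is_submoduleD[OF M N] and P' = is_submoduleD[OF M P]
  have PN: "is_submodule P NM"
    by (rule is_submoduleI[OF NM]) (use P' \<open>P \<subseteq> N\<close> in \<open>auto simp: NM_def\<close>)
  have L: "right_module L" unfolding L_def by (rule right_module_factor_module[OF NM PN])
  interpret L: right_module L by (rule L)
  define \<pi> where "\<pi> x = P +>\<^bsub>NM\<^esub> x" for x
  have carrier_L: "carrier L = \<pi> ` N"
    using carrier_factor_module[OF NM PN] by (simp add: L_def \<pi>_def NM_def)
  have pi_add: "\<pi> (x \<oplus> y) = \<pi> x \<oplus>\<^bsub>L\<^esub> \<pi> y" if "x \<in> N" "y \<in> N" for x y
    using coset_add[OF NM PN, of x y] that by (simp add: L_def \<pi>_def NM_def)
  have pi_act: "\<pi> (u \<odot> x) = u \<odot>\<^bsub>L\<^esub> \<pi> x" if "x \<in> N" for u x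
    using coset_act[OF NM PN, of x u] that by (simp add: L_def \<pi>_def NM_def)
  have pi_zero: "\<pi> x = \<zero>\<^bsub>L\<^esub> \<longleftrightarrow> x \<in> P" if "x \<in> N" for x
    using coset_eq_zero_iff[OF NM PN, of x] that by (simp add: L_def \<pi>_def NM_def)
  have pi_L: "\<pi> x \<in> carrier L" if "x \<in> N" for x using that by (simp add: carrier_L)
  note f_add = f_add[folded NM_def, folded L_def] and f_act = f_act[folded NM_def, folded L_def]
    and bij = bij[folded NM_def, folded L_def]
  have f_L: "f q \<in> carrier L" if "q \<in> carrier Q" for q using that bij by (rule bij_betwE[THEN bspec, rotated])
  have f_inj: "q = q'" if "q \<in> carrier Q" "q' \<in> carrier Q" "f q = f q'" for q q'
    using bij that by (auto simp: bij_betw_def inj_on_def)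
  have f_surj: "\<exists>q\<in>carrier Q. f q = \<pi> x" if "x \<in> N" for x
    using bij_betw_imp_surj_on[OF bij] pi_L[OF that] by (metis imageE)
  have f_ex: "\<exists>x\<in>N. f q = \<pi> x" if "q \<in> carrier Q" for q
    using f_L[OF that] by (auto simp: carrier_L)
  have f_zero: "f \<zero>\<^bsub>Q\<^esub> = \<zero>\<^bsub>L\<^esub>"
    using f_act[of "\<zero>\<^bsub>Q\<^esub>" 0] L.zero_act[OF f_L[of "\<zero>\<^bsub>Q\<^esub>"]] by (simp add: Q.act_zero)
  have ex_n: "\<exists>n. e n \<in> N \<and> e n \<notin> P"
  proof (rule ccontr)
    assume no: "\<nexists>n. e n \<in> N \<and> e n \<notin> P"
    have "x \<in> P" if "x \<in> N" for x
      by (rule mem_linear_subspace[OF submodule_imp_linear_subspace[OF M P]])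
        (use that no N'(1) e_mem_submodule[OF N that] in auto)
    then have "f q = f \<zero>\<^bsub>Q\<^esub>" if "q \<in> carrier Q" for q
      using f_ex[OF that] pi_zero f_zero by auto
    then have "q = \<zero>\<^bsub>Q\<^esub>" if "q \<in> carrier Q" for q
      using f_inj[OF that Q.zero_closed] that by blast
    then show False using Q_ne Q.zero_closed by blast
  qed
  define n where "n = (LEAST n. e n \<in> N \<and> e n \<notin> P)"
  have n: "e n \<in> N" "e n \<notin> P" using LeastI_ex[OF ex_n] by (simp_all add: n_def)
  have least: "e m \<in> P" if "m < n" "e m \<in> N" for m
    using not_less_Least[OF that(1)[unfolded n_def]] that(2) by blast
  obtain q\<^sub>0 where q0: "q\<^sub>0 \<in> carrier Q" "f q\<^sub>0 = \<pi> (e n)" using f_surj[OF n(1)] by blast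
  have q0_ne: "q\<^sub>0 \<noteq> \<zero>\<^bsub>Q\<^esub>" using q0 f_zero pi_zero[OF n(1)] n(2) by auto
  let ?T = "N \<inter> tail (Suc n)"
  note T' = is_submoduleD[OF M is_submodule_tail[of "Suc n"]]
  let ?W = "{q \<in> carrier Q. \<exists>x\<in>?T. f q = \<pi> x}"
  have "is_submodule ?W Q"
  proof (rule is_submoduleI[OF Q])
    show "\<zero>\<^bsub>Q\<^esub> \<in> ?W"
      using f_zero pi_zero[OF N'(2)] P'(2) N'(2) T'(2) Q.zero_closed by fastforce
    show "q \<oplus>\<^bsub>Q\<^esub> q' \<in> ?W" if qq: "q \<in> ?W" "q' \<in> ?W" for q q'
    proof -
      obtain x y where xy: "x \<in> ?T" "y \<in> ?T" "f q = \<pi> x" "f q' = \<pi> y" using qq by blast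
      then have "f (q \<oplus>\<^bsub>Q\<^esub> q') = \<pi> (x \<oplus> y)" using qq by (simp add: f_add pi_add)
      moreover have "x \<oplus> y \<in> ?T" using xy N'(3) T'(3) by blast
      ultimately show ?thesis using qq by blast
    qed
    show "u \<odot>\<^bsub>Q\<^esub> q \<in> ?W" if q: "q \<in> ?W" for q u
    proof -
      obtain x where x: "x \<in> ?T" "f q = \<pi> x" using q by blast
      then have "f (u \<odot>\<^bsub>Q\<^esub> q) = \<pi> (u \<odot> x)" using q by (simp add: f_act pi_act)
      moreover have "u \<odot> x \<in> ?T" using x N'(5) T'(5) by blast
      ultimately show ?thesis using q Q.act_closed by blast
    qed
  qed blast
  \<comment> \<open>Otherwise e n agrees modulo P with some x in the tail. The difference lies in P
    and has coordinate 1 at n, which puts e n into P.\<close>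
  moreover have "?W \<noteq> carrier Q"
  proof
    assume "?W = carrier Q"
    then obtain x where x: "x \<in> N" "x \<in> tail (Suc n)" "\<pi> (e n) = \<pi> x"
      using q0 by (smt (verit) IntD1 IntD2 mem_Collect_eq)
    let ?y = "e n \<oplus> (- 1) \<odot> x"
    have x': "x \<in> carrier M" using x(1) N'(1) by blast
    have mx: "(- 1) \<odot> x \<in> N" using N'(5)[OF x(1)] .
    have "\<pi> ?y = \<pi> (x \<oplus> (- 1) \<odot> x)" using x n mx by (simp add: pi_add)
    also have "x \<oplus> (- 1) \<odot> x = \<zero>" using x' by (simp add: minus_act act_one r_neg)
    also have "\<pi> \<zero> = \<zero>\<^bsub>L\<^esub>" using pi_zero[OF N'(2)] P'(2) by blast
    finally have "?y \<in> P" using pi_zero[of ?y] N'(3)[OF n(1) mx] by blast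
    moreover have "co ?y n \<noteq> 0" using x x' by (simp add: minus_act act_one co_add tail_def)
    ultimately show False using e_mem_submodule[OF P] n(2) by blast
  qed
  ultimately have W: "?W = {\<zero>\<^bsub>Q\<^esub>}" using Q_simple by blast
  have T_P: "x \<in> P" if xT: "x \<in> ?T" for x
  proof -
    obtain q where q: "q \<in> carrier Q" "f q = \<pi> x" using f_surj[OF IntD1[OF xT]] by (elim bexE)
    then have "q \<in> ?W" using xT by (intro CollectI conjI bexI)
    then have "f \<zero>\<^bsub>Q\<^esub> = \<pi> x" using q(2) unfolding W by simp
    then show ?thesis using f_zero pi_zero[of x] xT by auto
  qed
  have gen: "\<exists>s. q = const s \<odot>\<^bsub>Q\<^esub> q\<^sub>0" if q: "q \<in> carrier Q" for q
  proof -
    obtain x where x: "x \<in> N" "f q = \<pi> x" using f_ex[OF q] by (elim bexE)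
    have x': "x \<in> carrier M" using x(1) N'(1) by blast
    let ?s = "co x n"
    \<comment> \<open>Without its n-th component, x involves only basis elements of N before n,
      which lie in P by minimality, or after n, which lie in P by \<open>T_P\<close>.\<close>
    let ?y = "x \<oplus> const (- ?s) \<odot> e n"
    have y: "?y \<in> N" by (rule N'(3)[OF x(1) N'(5)[OF n(1)]])
    have "?y \<in> P"
    proof (rule mem_linear_subspace[OF submodule_imp_linear_subspace[OF M P]])
      fix m assume m: "co ?y m \<noteq> 0"
      then have "m \<noteq> n" using x' by (auto simp: co_add co_const act_closed simp del: const_simps)
      moreover have "e m \<in> N" by (rule e_mem_submodule[OF N y m])
      ultimately show "e m \<in> P" using least[of m] T_P[of "e m"] by (cases "m < n") (auto simp: tail_def)
    qed (use y N'(1) in blast)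
    then have "\<zero>\<^bsub>L\<^esub> = \<pi> ?y" using pi_zero[OF y] by simp
    moreover have "x = ?y \<oplus> const ?s \<odot> e n"
      by (rule co_eqI) (simp_all add: x' act_closed co_add co_const del: const_simps)
    moreover have en: "const ?s \<odot> e n \<in> N" by (rule N'(5)[OF n(1)])
    ultimately have "\<pi> x = \<zero>\<^bsub>L\<^esub> \<oplus>\<^bsub>L\<^esub> const ?s \<odot>\<^bsub>L\<^esub> \<pi> (e n)"
      using pi_add[OF y en] pi_act[OF n(1), of "const ?s"] by simp
    also have "\<dots> = f (const ?s \<odot>\<^bsub>Q\<^esub> q\<^sub>0)"
      using q0 f_act L.act_closed[OF pi_L[OF n(1)]] by simp
    finally have "q = const ?s \<odot>\<^bsub>Q\<^esub> q\<^sub>0"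
      using x(2) f_inj[OF q Q.act_closed[OF q0(1)]] by simp
    then show ?thesis by blast
  qed
  interpret vs: vectorspace class_ring "vs_of Q" by (rule vectorspace_vs_of[OF Q])
  have sub: "{q\<^sub>0} \<subseteq> carrier Q" using q0 by blast
  have "carrier Q \<subseteq> lin_span Q {q\<^sub>0}"
    using gen linear_subspace_lin_span[OF Q sub] lin_span_superset[OF Q sub]
    unfolding linear_subspace_def by (metis insert_subset subsetI)
  then have span: "lin_span Q {q\<^sub>0} = carrier Q" using lin_span_subset_carrier[OF Q sub] by (intro equalityI)
  then have "fin_dim Q" unfolding fin_dim_iff[OF Q] by (intro exI[of _ "{q\<^sub>0}"]) (simp add: q0)
  moreover have "lin_dim Q = 1" using vs.dim1I[of "q\<^sub>0"] span q0_ne q0 by simp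
  ultimately show ?thesis by (simp add: one_dimensional_def)
qed

definition gen :: 'm
  where "gen = elem root"

lemma gen [simp]: "gen \<in> carrier M" "co gen = root"
proof -
  have "finite {n. root n \<noteq> 0}" using finite_block[of 0] by (simp add: root_def)
  then show "gen \<in> carrier M" "co gen = root" using elem[of root] by (simp_all add: gen_def)
qed

text \<open>The multiples of \<open>gen\<close> form a submodule, so it contains each basis element
  occurring in a member. Block 0 occurs in \<open>gen\<close>, and a later block occurs in the
  product of its parent basis element with its label.\<close>

lemma carrier_eq_multiples: "carrier M = {u \<odot> gen | u. True}" (is "_ = ?U")
proof
  show "?U \<subseteq> carrier M" by (auto simp: act_closed)
  have U: "is_submodule ?U M"
  proof (rule is_submoduleI[OF M])
    show "\<zero> \<in> ?U" using zero_act[of gen] by (metis (mono_tags, lifting) gen(1) mem_Collect_eq)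
    show "x \<oplus> y \<in> ?U" if "x \<in> ?U" "y \<in> ?U" for x y
      using that act_add_right[OF gen(1)] by (smt (verit) mem_Collect_eq)
    show "u \<odot> x \<in> ?U" if "x \<in> ?U" for x u
      using that act_assoc[OF gen(1)] by (smt (verit) mem_Collect_eq)
  qed (auto simp: act_closed)
  have "1 \<odot> gen \<in> ?U" by blast
  then have gen_U: "gen \<in> ?U" by (simp add: act_one)
  have e_U: "e n \<in> ?U" for n
  proof (induction n rule: less_induct)
    case (less n)
    show ?case
    proof (cases "lev n = 0")
      case True
      then show ?thesis by (intro e_mem_submodule[OF U gen_U]) (simp add: root_def)
    next
      case False
      let ?y = "var (lab (lev n)) \<odot> e (par (lev n))"
      have "?y \<in> ?U" by (rule is_submoduleD(5)[OF M U]) (use less par_less False in auto)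
      moreover have "co ?y n \<noteq> 0" using False lab_neq by (simp add: co_var step_def)
      ultimately show ?thesis by (rule e_mem_submodule[OF U])
    qed
  qed
  show "carrier M \<subseteq> ?U"
    using mem_linear_subspace[OF submodule_imp_linear_subspace[OF M U]] e_U by blast
qed

lemma cyclic_M: "cyclic_module M"
  unfolding cyclic_module_def using M carrier_eq_multiples gen(1) by blast

text \<open>In a right action the first letter acts first, whereas \<open>foldr\<close> lets the
  last one act first; hence the reversal.\<close>

lemma co_word: "co (Poly_Mapping.single (Monomial w) 1 \<odot> gen) = coords (rev w)"
proof (induction w rule: rev_induct)
  case Nil
  have "Poly_Mapping.single (Monomial []) 1 = (1 :: ('k, 'x) free_alg)"
    by (simp flip: zero_monomial_def)
  then show ?case by (simp add: act_one)
next
  case (snoc j w)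
  then show ?case
    by (intro ext) (simp add: single_snoc act_assoc co_var act_closed)
qed

end

section \<open>Growth\<close>

abbreviation word :: "'x list \<Rightarrow> ('k::field, 'x) free_alg"
  where "word w \<equiv> Poly_Mapping.single (Monomial w) 1"

lemma finite_words: "finite {w :: 'x::finite list. length w \<le> n}"
  using finite_lists_length_le[of "UNIV :: 'x set" n] by simp

lemma bounded_degree_eq:
  "(bounded_degree n :: ('k::field, 'x) free_alg set) = lin_span regular_module (word ` {w. length w \<le> n})"
proof -
  have "{Poly_Mapping.single w 1 | w. length (letters w) \<le> n} = (word ` {w. length w \<le> n} :: ('k::field, 'x) free_alg set)"
    by (auto simp: image_iff) (metis monomial.exhaust_sel)
  then show ?thesis by (simp add: bounded_degree_def)
qed

lemma linear_subspace_bounded_degree: "linear_subspace regular_module (bounded_degree n)"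
  unfolding bounded_degree_eq by (rule linear_subspace_lin_span[OF right_module_regular]) simp

lemma word_mem_bounded_degree: "length w \<le> n \<Longrightarrow> word w \<in> bounded_degree n"
  unfolding bounded_degree_eq
  using lin_span_superset[OF right_module_regular, of "word ` {w. length w \<le> n}"] by auto

lemma bounded_degree_subset:
  assumes "linear_subspace regular_module W" "\<And>w. length w \<le> n \<Longrightarrow> word w \<in> W"
  shows "bounded_degree n \<subseteq> W"
  unfolding bounded_degree_eq by (rule lin_span_minimal[OF right_module_regular assms(1)]) (use assms(2) in auto)

lemma bounded_degree_mono: "m \<le> n \<Longrightarrow> bounded_degree m \<subseteq> bounded_degree n"
  by (intro bounded_degree_subset linear_subspace_bounded_degree word_mem_bounded_degree) simp

lemma linear_subspace_regular_iff:
  "linear_subspace regular_module W \<longleftrightarrow>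
    0 \<in> W \<and> (\<forall>x\<in>W. \<forall>y\<in>W. x + y \<in> W) \<and> (\<forall>s. \<forall>x\<in>W. x * const s \<in> W)"
  by (simp add: linear_subspace_def)

lemma bounded_degree_mult:
  fixes u v :: "('k::field, 'x) free_alg"
  assumes "u \<in> bounded_degree m" "v \<in> bounded_degree n"
  shows "u * v \<in> bounded_degree (m + n)"
proof -
  have const_right: "u * const s * v = u * v * const s" for u v :: "('k, 'x) free_alg" and s
    by (simp add: mult.assoc const_commute[of s v])
  note B = linear_subspace_bounded_degree[where 'a = 'x and 'b = 'k, unfolded linear_subspace_regular_iff]
  let ?S = "{u :: ('k, 'x) free_alg. \<forall>v\<in>bounded_degree n. u * v \<in> bounded_degree (m + n)}"
  have "bounded_degree m \<subseteq> ?S"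
  proof (rule bounded_degree_subset)
    show "linear_subspace regular_module ?S"
      unfolding linear_subspace_regular_iff
      using B by (auto simp: distrib_right const_right)
    fix w :: "'x list" assume w: "length w \<le> m"
    let ?T = "{v :: ('k, 'x) free_alg. word w * v \<in> bounded_degree (m + n)}"
    have "bounded_degree n \<subseteq> ?T"
    proof (rule bounded_degree_subset)
      show "linear_subspace regular_module ?T"
        unfolding linear_subspace_regular_iff
        using B by (auto simp: distrib_left simp flip: mult.assoc)
      fix w' :: "'x list" assume "length w' \<le> n"
      then show "word w' \<in> ?T"
        using w by (auto simp: mult_single plus_monomial_def intro!: word_mem_bounded_degree)
    qed
    then show "word w \<in> ?S" by blast
  qed
  then show ?thesis using assms by blast
qed

lemma ex_bounded_degree:
  fixes u :: "('k::field, 'x) free_alg"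
  shows "\<exists>n. u \<in> bounded_degree n"
proof (induction u rule: free_alg_induct)
  case zero
  then show ?case using linear_subspace_bounded_degree[of 0] by (auto simp: linear_subspace_regular_iff)
next
  case (single w s)
  have "word w * const s \<in> bounded_degree (length w)"
    using linear_subspace_bounded_degree[of "length w", where 'a = 'x and 'b = 'k]
      word_mem_bounded_degree[of w "length w", where 'b = 'k]
    unfolding linear_subspace_regular_iff by blast
  then show ?case by (auto simp: const_def mult_single)
next
  case (add u v)
  then obtain m n where "u \<in> bounded_degree m" "v \<in> bounded_degree n" by blast
  then have "u \<in> bounded_degree (max m n)" "v \<in> bounded_degree (max m n)"
    using bounded_degree_mono[OF max.cobounded1[of m n]] bounded_degree_mono[OF max.cobounded2[of n m]] by blast+
  then show ?case using linear_subspace_bounded_degree[of "max m n"]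
    by (auto simp: linear_subspace_regular_iff)
qed

lemma lookup_times_const: "Poly_Mapping.lookup (u * const s) w = s * Poly_Mapping.lookup u (w :: 'x monomial)"
proof (induction u rule: free_alg_induct)
  case (single v r)
  then show ?case by (simp add: const_def mult_single lookup_single when_def)
qed (simp_all add: distrib_right distrib_left lookup_add)

lemma growth_regular:
  "growth (regular_module :: (('k::field, 'x::finite) free_alg, ('k, 'x) free_alg) module) {1} n
    = card {w :: 'x list. length w \<le> n}"
proof -
  let ?R = "regular_module :: (('k, 'x) free_alg, ('k, 'x) free_alg) module"
  let ?W = "{w :: 'x list. length w \<le> n}"
  note R = right_module_regular[where 'r = "('k, 'x) free_alg"]
  have "{u \<odot>\<^bsub>?R\<^esub> x | x u. x \<in> {1} \<and> u \<in> bounded_degree n} = bounded_degree n" by auto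
  then have "act_span ?R {1} (bounded_degree n) = lin_span ?R (bounded_degree n)"
    by (simp add: act_span_def)
  also have "\<dots> = bounded_degree n"
    by (intro equalityI lin_span_minimal[OF R linear_subspace_bounded_degree] lin_span_superset[OF R]) simp_all
  finally have act: "act_span ?R {1} (bounded_degree n) = bounded_degree n" .
  have X: "finite (word ` ?W :: ('k, 'x) free_alg set)" "(word ` ?W :: ('k, 'x) free_alg set) \<subseteq> carrier ?R"
    "bounded_degree n \<subseteq> lin_span ?R (word ` ?W)"
    by (simp_all add: finite_words bounded_degree_eq)
  note dim = lin_dim_subspace_le[OF R linear_subspace_bounded_degree X]
  have "card ?W \<le> lin_dim (?R\<lparr>carrier := bounded_degree n\<rparr>)"
  proof (rule card_le_lin_dim_subspace[OF R linear_subspace_bounded_degree dim(1)])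
    show "word ` ?W \<subseteq> bounded_degree n" using word_mem_bounded_degree by auto
    show "linear_functional ?R (\<lambda>u. Poly_Mapping.lookup u w)" for w
      by (simp add: linear_functional_def lookup_add lookup_times_const)
    fix J :: "'x list set" and s :: "'x list \<Rightarrow> 'k"
    assume J: "finite J" and zero: "\<forall>w. (\<Sum>v\<in>J. s v * Poly_Mapping.lookup (word v) w) = 0"
    show "\<forall>v\<in>J. s v = 0"
    proof
      fix w assume "w \<in> J"
      have "(\<Sum>v\<in>J. s v * Poly_Mapping.lookup (word v) (Monomial w)) = (\<Sum>v\<in>J. if v = w then s v else 0)"
        by (rule sum.cong) (auto simp: lookup_single when_def)
      then show "s w = 0" using zero J \<open>w \<in> J\<close> by (simp add: sum.delta)
    qed
  qed
  then show ?thesis using dim(2) card_image_le[OF finite_words[of n], of "word :: 'x list \<Rightarrow> ('k, 'x) free_alg"]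
    by (simp add: growth_def act)
qed

context tree_module
begin

lemma multiple_mem_span_words:
  fixes u :: "('k, 'x) free_alg"
  assumes "u \<in> bounded_degree n"
  shows "u \<odot> gen \<in> lin_span M ((\<lambda>w. word w \<odot> gen) ` {w. length w \<le> n})" (is "_ \<in> lin_span M ?X")
proof -
  have X: "?X \<subseteq> carrier M" by (auto simp: act_closed)
  note S = linear_subspace_lin_span[OF M X] and X_S = lin_span_superset[OF M X]
  have "bounded_degree n \<subseteq> {u. u \<odot> gen \<in> lin_span M ?X}"
  proof (rule bounded_degree_subset)
    show "linear_subspace regular_module {u. u \<odot> gen \<in> lin_span M ?X}"
      using S by (auto simp: linear_subspace_regular_iff linear_subspace_def zero_act act_add_right act_assoc)
  qed (use X_S in auto)
  then show ?thesis using assms by blast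
qed

lemma act_span_subset_span_words:
  assumes "\<And>x. x \<in> A \<Longrightarrow> \<exists>v\<in>bounded_degree d. x = v \<odot> gen"
  shows "act_span M A (bounded_degree n) \<subseteq> lin_span M ((\<lambda>w. word w \<odot> gen) ` {w. length w \<le> n + d})"
    (is "_ \<subseteq> lin_span M ?X")
proof -
  have X: "?X \<subseteq> carrier M" by (auto simp: act_closed)
  show ?thesis
    unfolding act_span_def
  proof (rule lin_span_minimal[OF M linear_subspace_lin_span[OF M X]], clarify)
    fix x and u :: "('k, 'x) free_alg" assume "x \<in> A" "u \<in> bounded_degree n"
    then obtain v where v: "v \<in> bounded_degree d" "x = v \<odot> gen" using assms by blast
    then have "u \<odot> x = (v * u) \<odot> gen" by (simp add: act_assoc)
    moreover have "v * u \<in> bounded_degree (n + d)"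
      using bounded_degree_mult[OF v(1) \<open>u \<in> bounded_degree n\<close>] by (simp add: add.commute)
    ultimately show "u \<odot> x \<in> lin_span M ?X" using multiple_mem_span_words by simp
  qed
qed

lemma linear_subspace_act_span: "A \<subseteq> carrier M \<Longrightarrow> linear_subspace M (act_span M A I)"
  unfolding act_span_def by (rule linear_subspace_lin_span[OF M]) (auto simp: act_closed)

lemma act_mem_act_span:
  assumes "A \<subseteq> carrier M" "x \<in> A" "u \<in> I"
  shows "u \<odot> x \<in> act_span M A I"
  unfolding act_span_def
  by (rule subsetD[OF lin_span_superset[OF M]]) (use assms in \<open>auto simp: act_closed\<close>)

lemma act_span_mono: "I \<subseteq> J \<Longrightarrow> act_span M A I \<subseteq> act_span M A J"
  unfolding act_span_def by (rule lin_span_mono[OF M]) blast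

lemma act_act_span_bounded_degree:
  fixes u :: "('k, 'x) free_alg"
  assumes A: "A \<subseteq> carrier M" and "x \<in> act_span M A (bounded_degree d)" "u \<in> bounded_degree n"
  shows "u \<odot> x \<in> act_span M A (bounded_degree (d + n))"
proof -
  note S = linear_subspace_act_span[OF A, of "bounded_degree (d + n)"]
  have "act_span M A (bounded_degree d) \<subseteq> {x \<in> carrier M. u \<odot> x \<in> act_span M A (bounded_degree (d + n))}"
    unfolding act_span_def[of M A "bounded_degree d"]
  proof (rule lin_span_minimal[OF M])
    have "u \<odot> (const s \<odot> x) = const s \<odot> (u \<odot> x)" if "x \<in> carrier M" for s x
      using act_assoc[OF that, of "const s" u] act_assoc[OF that, of u "const s"] by (simp add: const_commute[of s u])
    then show "linear_subspace M {x \<in> carrier M. u \<odot> x \<in> act_span M A (bounded_degree (d + n))}"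
      using S by (auto simp: linear_subspace_def act_closed act_zero act_add_left)
    show "{v \<odot> x | x v. x \<in> A \<and> v \<in> bounded_degree d} \<subseteq> {x \<in> carrier M. u \<odot> x \<in> act_span M A (bounded_degree (d + n))}"
    proof clarify
      fix x and v :: "('k, 'x) free_alg" assume x: "x \<in> A" and v: "v \<in> bounded_degree d"
      have "u \<odot> (v \<odot> x) = (v * u) \<odot> x" using act_assoc[of x v u] x A by auto
      then show "v \<odot> x \<in> carrier M \<and> u \<odot> (v \<odot> x) \<in> act_span M A (bounded_degree (d + n))"
        using act_mem_act_span[OF A x bounded_degree_mult[OF v assms(3)]] x A by (auto simp: act_closed)
    qed
  qed
  then show ?thesis using assms(2) by blast
qed

text \<open>The spans A R(d) increase with d and their union is a submodule containing A, so it is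
  the whole module.\<close>

lemma gen_mem_act_span:
  assumes "finite_generating_set M A"
  shows "\<exists>d. gen \<in> act_span M A (bounded_degree d)"
proof -
  have A: "A \<subseteq> carrier M" and A_gen: "generated_submodule M A = carrier M"
    using assms by (auto simp: finite_generating_set_def)
  let ?U = "\<Union>d. act_span M A (bounded_degree d)"
  note S = linear_subspace_act_span[OF A]
  have U: "is_submodule ?U M"
  proof (rule is_submoduleI[OF M])
    show "?U \<subseteq> carrier M" "\<zero> \<in> ?U" using S unfolding linear_subspace_def by blast+
    show "x \<oplus> y \<in> ?U" if xy: "x \<in> ?U" "y \<in> ?U" for x y
    proof -
      obtain m n where "x \<in> act_span M A (bounded_degree m)" "y \<in> act_span M A (bounded_degree n)" using xy by blast
      then have "x \<in> act_span M A (bounded_degree (max m n))" "y \<in> act_span M A (bounded_degree (max m n))"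
        using act_span_mono[OF bounded_degree_mono[OF max.cobounded1[of m n]], of A]
          act_span_mono[OF bounded_degree_mono[OF max.cobounded2[of n m]], of A] by blast+
      then show ?thesis using S[of "bounded_degree (max m n)"] by (auto simp: linear_subspace_def)
    qed
    show "u \<odot> x \<in> ?U" if x: "x \<in> ?U" for x u
    proof -
      obtain d n where "x \<in> act_span M A (bounded_degree d)" "u \<in> bounded_degree n"
        using x ex_bounded_degree[of u] by blast
      then show ?thesis using act_act_span_bounded_degree[OF A] by blast
    qed
  qed
  have "A \<subseteq> ?U"
  proof
    fix x assume x: "x \<in> A"
    have "(1 :: ('k, 'x) free_alg) \<in> bounded_degree 0"
      using word_mem_bounded_degree[of "[]" 0] by (simp flip: zero_monomial_def)
    then have "1 \<odot> x \<in> act_span M A (bounded_degree 0)" by (rule act_mem_act_span[OF A x])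
    then show "x \<in> ?U" using x A act_one[of x] by (metis UN_I UNIV_I subsetD)
  qed
  then have "carrier M \<subseteq> ?U" using generated_submodule_subset[OF U] A_gen by blast
  then show ?thesis using gen(1) by blast
qed

lemma finite_generating_set_gen: "finite_generating_set M {gen}"
proof -
  have "carrier M \<subseteq> generated_submodule M {gen}"
  proof
    fix x assume "x \<in> carrier M"
    then obtain u where "x = u \<odot> gen" using carrier_eq_multiples by auto
    moreover have "gen \<in> generated_submodule M {gen}" using generated_submodule_superset[of "{gen}" M] by simp
    ultimately show "x \<in> generated_submodule M {gen}"
      using is_submoduleD(5)[OF M is_submodule_generated[OF M]] by simp
  qed
  moreover have "generated_submodule M {gen} \<subseteq> carrier M"
    by (rule generated_submodule_subset[OF is_submodule_carrier[OF M]]) simp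
  ultimately show ?thesis unfolding finite_generating_set_def using gen(1) by blast
qed

text \<open>If A lies in gen R(d), then A R(n) lies in gen R(n + d), whose dimension is at most the
  number of words of length at most n + d. If gen lies in A R(d'), then A R(n + 2 + d') contains gen
  R(n + 2), in which the sparse words of length n + 2 give independent vectors.\<close>

lemma maximal_growth_M:
  assumes "card (UNIV :: 'x set) > 1"
  shows "maximal_growth M"
  unfolding maximal_growth_def
proof (intro conjI allI impI)
  show "\<exists>A. finite_generating_set M A" using finite_generating_set_gen by blast
  fix A assume A_gen: "finite_generating_set M A"
  then have A: "A \<subseteq> carrier M" "finite A" by (auto simp: finite_generating_set_def)
  let ?R = "regular_module :: (('k, 'x) free_alg, ('k, 'x) free_alg) module"
  have "\<exists>d. \<forall>x\<in>A. \<exists>v\<in>bounded_degree d. x = v \<odot> gen"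
    using A(2,1)
  proof (induction A rule: finite_induct)
    case (insert x A)
    then obtain d where d: "\<forall>x\<in>A. \<exists>v\<in>bounded_degree d. x = v \<odot> gen" by auto
    obtain u where u: "x = u \<odot> gen" using insert carrier_eq_multiples by auto
    obtain m where m: "u \<in> bounded_degree m" using ex_bounded_degree by blast
    show ?case
    proof (intro exI ballI)
      fix y assume "y \<in> insert x A"
      then show "\<exists>v\<in>bounded_degree (max d m). y = v \<odot> gen"
        using d u m bounded_degree_mono[of d "max d m"] bounded_degree_mono[of m "max d m"] by fastforce
    qed
  qed simp
  then obtain d where d: "\<And>x. x \<in> A \<Longrightarrow> \<exists>v\<in>bounded_degree d. x = v \<odot> gen" by blast
  obtain d' where d': "gen \<in> act_span M A (bounded_degree d')" using gen_mem_act_span[OF A_gen] by blast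
  have sub: "linear_subspace M (act_span M A (bounded_degree n))" for n
    by (rule linear_subspace_act_span[OF A(1)])
  have X: "finite ((\<lambda>w. word w \<odot> gen) ` {w :: 'x list. length w \<le> n})"
    "(\<lambda>w. word w \<odot> gen) ` {w :: 'x list. length w \<le> n} \<subseteq> carrier M" for n
    by (auto simp: finite_words act_closed)
  note dim = lin_dim_subspace_le[OF M sub X act_span_subset_span_words[OF d]]
  have upper: "growth M A n \<le> growth ?R {1} (n + d)" for n
    using dim(2)[of n] card_image_le[OF finite_words[of "n + d"], of "\<lambda>w. word w \<odot> gen"]
    by (simp add: growth_regular growth_def[of M])
  have lower: "growth ?R {1} n \<le> growth M A (n + (2 + d'))" for n
  proof -
    let ?I = "{w. length w = n + 2 \<and> sparse_word c w}"
    have "growth ?R {1} n \<le> card ?I"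
      unfolding growth_regular by (rule card_words_le_card_sparse_words) (use assms in simp)
    also have "\<dots> \<le> lin_dim (M\<lparr>carrier := act_span M A (bounded_degree (n + (2 + d')))\<rparr>)"
    proof (rule card_le_lin_dim_subspace[OF M sub dim(1) _ functional_co])
      \<comment> \<open>Sparse words are read backwards, so the algebra element is the reversed
        word.\<close>
      show "(\<lambda>w. word (rev w) \<odot> gen) ` ?I \<subseteq> act_span M A (bounded_degree (n + (2 + d')))"
      proof clarify
        fix w :: "'x list" assume "length w = n + 2"
        then have "word (rev w) \<in> bounded_degree (n + 2)" by (intro word_mem_bounded_degree) simp
        then have "word (rev w) \<odot> gen \<in> act_span M A (bounded_degree (d' + (n + 2)))"
          by (rule act_act_span_bounded_degree[OF A(1) d'])
        then show "word (rev w) \<odot> gen \<in> act_span M A (bounded_degree (n + (2 + d')))" by (simp add: ac_simps)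
      qed
      fix J s assume J: "finite J" "J \<subseteq> ?I" "\<forall>k. (\<Sum>w\<in>J. s w * co (word (rev w) \<odot> gen) k) = 0"
      \<comment> \<open>The coefficients are extended by zero, since
        \<open>coords_independent\<close> sums over all words up to a given length.\<close>
      let ?f = "\<lambda>w. if w \<in> J then s w else 0"
      have "?f w = 0" for w
      proof (rule coords_independent[of ?f "n + 2"])
        fix k
        have "(\<Sum>w | length w \<le> n + 2. ?f w * coords w k) = (\<Sum>w\<in>J. s w * coords w k)"
          by (rule sum.mono_neutral_cong_right) (use J(2) in \<open>auto simp: finite_words\<close>)
        then show "(\<Sum>w | length w \<le> n + 2. ?f w * coords w k) = 0" using J(3) by (simp add: co_word)
      qed (use J(2) in \<open>auto split: if_splits\<close>)
      then show "\<forall>w\<in>J. s w = 0" by (metis (full_types))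
    qed
    finally show ?thesis by (simp add: growth_def[of M])
  qed
  show "equivalent_growth (growth M A) (growth ?R {1})"
    unfolding equivalent_growth_def using upper lower by blast
qed

end

section \<open>Construction of the module\<close>

text \<open>Modulo the right ideal every u is congruent to a scalar s, so u x = (u - s) x + s x with
  s central, and both terms lie in the ideal when x does: u - s is in the ideal, and s x = x
  s.\<close>

lemma ideal_Delta:
  fixes \<alpha> :: "'x \<Rightarrow> nat \<Rightarrow> 'k::field"
  shows "ideal (Delta \<alpha> i) class_ring"
proof -
  let ?D = "Delta \<alpha> i"
  have D: "is_submodule ?D regular_module"
    unfolding Delta_def by (rule is_submodule_generated[OF right_module_regular]) simp
  have gen_D: "var j - const (\<alpha> j i) \<in> ?D" for j
    unfolding Delta_def by (rule subsetD[OF generated_submodule_superset]) blast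
  note D' = is_submoduleD[OF right_module_regular D, simplified]
  have mod_D: "u \<in> {y. \<exists>s. y - const s \<in> ?D}" for u
  proof (rule right_ideal_UNIV)
    show "const s \<in> {y. \<exists>s. y - const s \<in> ?D}" for s
      using D'(2) by (auto intro: exI[of _ s])
    show "u + v \<in> {y. \<exists>s. y - const s \<in> ?D}"
      if uv: "u \<in> {y. \<exists>s. y - const s \<in> ?D}" "v \<in> {y. \<exists>s. y - const s \<in> ?D}" for u v
    proof -
      obtain s t where "u - const s \<in> ?D" "v - const t \<in> ?D" using uv by blast
      then have "(u - const s) + (v - const t) \<in> ?D" by (rule D'(3))
      then have "u + v - const (s + t) \<in> ?D" by (simp add: algebra_simps)
      then show ?thesis by blast
    qed
    show "u * var j \<in> {y. \<exists>s. y - const s \<in> ?D}" if u: "u \<in> {y. \<exists>s. y - const s \<in> ?D}" for u j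
    proof -
      obtain s where s: "u - const s \<in> ?D" using u by blast
      \<comment> \<open>If u is congruent to s, then u times letter j is congruent to s times
        \<open>\<alpha> j i\<close>; the two summands split the difference.\<close>
      have "(u - const s) * var j + (var j - const (\<alpha> j i)) * const s \<in> ?D"
        using D'(3,5) s gen_D by blast
      also have "(var j - const (\<alpha> j i)) * const s = const s * (var j - const (\<alpha> j i))"
        by (rule const_commute[symmetric])
      also have "(u - const s) * var j + const s * (var j - const (\<alpha> j i)) = u * var j - const (s * \<alpha> j i)"
        by (simp add: algebra_simps)
      finally have "u * var j - const (s * \<alpha> j i) \<in> ?D" .
      then show ?thesis by blast
    qed
  qed
  show ?thesis
  proof (rule idealI)
    show "ring (class_ring :: ('k, 'x) free_alg ring)" by (rule class_ring.ring_axioms)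
    show "subgroup ?D (add_monoid class_ring)"
    proof (rule group.subgroupI)
      show "group (add_monoid (class_ring :: ('k, 'x) free_alg ring))"
        by (rule abelian_group.a_group[OF ring.is_abelian_group[OF class_ring.ring_axioms]])
      show "inv\<^bsub>add_monoid class_ring\<^esub> x \<in> ?D" if "x \<in> ?D" for x
        unfolding a_inv_def[symmetric] using D'(5)[OF that, of "- 1"] by (simp add: class_ring_simps)
    qed (use D'(2,3) in auto)
    fix x u assume x: "x \<in> ?D"
    show "x \<otimes>\<^bsub>class_ring\<^esub> u \<in> ?D" using D'(5)[OF x] by simp
    obtain s where s: "u - const s \<in> ?D" using mod_D by blast
    have "(u - const s) * x + x * const s \<in> ?D" using D'(3,5) s x by blast
    then show "u \<otimes>\<^bsub>class_ring\<^esub> x \<in> ?D" by (simp add: algebra_simps const_commute[of s x])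
  qed
qed

lemma floor_log_eq_iff:
  "0 < n \<Longrightarrow> floor_log n = l \<longleftrightarrow> 2 ^ l \<le> n \<and> n < 2 ^ Suc l"
  using floor_log_exp2_le[of n] floor_log_exp2_gt[of n] floor_log_eqI[of n l] by auto

text \<open>Block \<open>l\<close> consists of the \<open>2\<^sup>l\<^sup>+\<^sup>1\<close> numbers from \<open>2\<^sup>l\<^sup>+\<^sup>1 - 2\<close> on; block \<open>l + 1\<close> is attached to
  the basis element and the letter that are encoded by quotient and remainder of \<open>l\<close>.\<close>

lemma ex_block_tree:
  fixes c :: "'x::finite" and a :: "nat \<Rightarrow> 'k::field"
  assumes "card (UNIV :: 'x set) > 1" "inj a"
  shows "\<exists>lev par lab. block_tree c a lev par lab"
proof -
  define q where "q = card (UNIV :: 'x set) - 1"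
  have q: "0 < q" using assms(1) by (simp add: q_def)
  have "card (UNIV - {c}) = q" by (simp add: q_def)
  then obtain h where h: "bij_betw h {0..<q} (UNIV - {c})"
    using ex_bij_betw_nat_finite[of "UNIV - {c}"] by auto
  \<comment> \<open>The shift by 2 starts the dyadic intervals at [2, 4), so that block 0 already
    has two elements; there the logarithm is at least 1 and the subtraction is not
    truncated.\<close>
  define lev where "lev n = floor_log (n + 2) - 1" for n
  define par where "par l = (l - 1) div q" for l
  define lab where "lab l = h ((l - 1) mod q)" for l
  have lev_iff: "lev n = l \<longleftrightarrow> 2 ^ Suc l \<le> n + 2 \<and> n + 2 < 2 ^ Suc (Suc l)" for n l
  proof -
    have "floor_log (n + 2) \<noteq> 0" using floor_log_eq_iff[of "n + 2" 0] by simp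
    then have "lev n = l \<longleftrightarrow> floor_log (n + 2) = Suc l" by (auto simp: lev_def)
    then show ?thesis using floor_log_eq_iff[of "n + 2" "Suc l"] by simp
  qed
  \<comment> \<open>With \<open>par_less\<close> this gives both inequalities of the locale:
    \<open>par (lev n) < lev n \<le> n\<close> and
    \<open>lev (par l) \<le> par l < l\<close>.\<close>
  have lev_le: "lev n \<le> n" for n
  proof -
    have "Suc (lev n) < 2 ^ Suc (lev n)" by (rule less_exp)
    then show ?thesis using lev_iff[of n "lev n"] by linarith
  qed
  have par_less: "par l < l" if "0 < l" for l
    using that div_le_dividend[of "l - 1" q] unfolding par_def by linarith
  have "block_tree c a lev par lab"
  proof
    show "inj a" by fact
    show "card {n. lev n = l} = 2 ^ Suc l" for l
    proof -
      have "(2::nat) \<le> 2 ^ Suc l" by simp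
      moreover from this have "{n. lev n = l} = {2 ^ Suc l - 2..<2 ^ Suc (Suc l) - 2}"
        by (auto simp: lev_iff simp del: power_Suc)
      then have "card {n. lev n = l} = (2 ^ Suc (Suc l) - 2) - (2 ^ Suc l - 2)"
        by (simp only: card_atLeastLessThan)
      moreover have "2 ^ Suc (Suc l) = 2 * (2::nat) ^ Suc l" by simp
      ultimately show ?thesis by linarith
    qed
    show "par (lev n) < n" if "0 < lev n" for n
      using par_less[OF that] lev_le[of n] by linarith
    show "lev (par l) < l" if "0 < l" for l
      using par_less[OF that] lev_le[of "par l"] by linarith
    show "lab l \<noteq> c" if "0 < l" for l
      using bij_betwE[OF h] q by (auto simp: lab_def)
    show "\<exists>l>0. par l = p \<and> lab l = j" if "j \<noteq> c" for j p
    proof -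
      have "j \<in> h ` {0..<q}" using bij_betw_imp_surj_on[OF h] that by simp
      then obtain t where "t < q" "h t = j" by auto
      then show ?thesis by (intro exI[of _ "Suc (t + p * q)"]) (simp add: par_def lab_def)
    qed
    show "finite {l. 0 < l \<and> par l \<le> b}" for b
    proof (rule finite_subset)
      show "{l. 0 < l \<and> par l \<le> b} \<subseteq> {..Suc b * q}"
        using q by (auto simp: par_def less_Suc_eq_le[symmetric] div_less_iff_less_mult)
    qed simp
  qed
  then show ?thesis by blast
qed

section \<open>Realisation on finitely supported functions\<close>

context block_tree
begin

text \<open>The linear extension of the action of words; \<open>fold\<close> lets the first letter
  act first, as a right action requires.\<close>

definition act :: "('k, 'x) free_alg \<Rightarrow> (nat \<Rightarrow> 'k) \<Rightarrow> nat \<Rightarrow> 'k"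
  where "act u v n = (\<Sum>w\<in>Poly_Mapping.keys u. Poly_Mapping.lookup u w * fold step (letters w) v n)"

lemma step_add: "step j (\<lambda>n. v n + v' n) = (\<lambda>n. step j v n + step j v' n)"
  by (rule ext) (simp add: step_def algebra_simps)

lemma step_scale: "step j (\<lambda>n. s * v n) = (\<lambda>n. s * step j v n)"
  by (rule ext) (simp add: step_def)

lemma fold_step_add: "fold step w (\<lambda>n. v n + v' n) = (\<lambda>n. fold step w v n + fold step w v' n)"
  by (induction w arbitrary: v v') (simp_all add: step_add)

lemma fold_step_scale: "fold step w (\<lambda>n. s * v n) = (\<lambda>n. s * fold step w v n)"
  by (induction w arbitrary: v) (simp_all add: step_scale)

text \<open>Only finitely many blocks hang at the indices up to a bound, and each block is
  finite.\<close>

lemma finite_support_step: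
  assumes "finite {n. v n \<noteq> 0}"
  shows "finite {n. step j v n \<noteq> 0}"
proof -
  obtain b where b: "\<And>n. v n \<noteq> 0 \<Longrightarrow> n \<le> b" using assms by (auto simp: finite_nat_set_iff_bounded_le)
  have "{n. step j v n \<noteq> 0} \<subseteq> {n. v n \<noteq> 0} \<union> (\<Union>l\<in>{l. 0 < l \<and> par l \<le> b}. {n. lev n = l})"
    using b by (auto simp: step_def split: if_splits)
  then show ?thesis using assms finite_par finite_block by (auto intro: finite_subset)
qed

lemma finite_support_fold_step: "finite {n. v n \<noteq> 0} \<Longrightarrow> finite {n. fold step w v n \<noteq> 0}"
  by (induction w arbitrary: v) (simp_all add: finite_support_step)

lemma finite_support_act:
  assumes "finite {n. v n \<noteq> 0}"
  shows "finite {n. act u v n \<noteq> 0}"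
proof (rule finite_subset)
  show "{n. act u v n \<noteq> 0} \<subseteq> (\<Union>w\<in>Poly_Mapping.keys u. {n. fold step (letters w) v n \<noteq> 0})"
  proof
    fix n assume "n \<in> {n. act u v n \<noteq> 0}"
    then obtain w where "w \<in> Poly_Mapping.keys u" "Poly_Mapping.lookup u w * fold step (letters w) v n \<noteq> 0"
      unfolding act_def mem_Collect_eq by (rule sum.not_neutral_contains_not_neutral)
    then show "n \<in> (\<Union>w\<in>Poly_Mapping.keys u. {n. fold step (letters w) v n \<noteq> 0})" by auto
  qed
  show "finite (\<Union>w\<in>Poly_Mapping.keys u. {n. fold step (letters w) v n \<noteq> 0})"
    using finite_support_fold_step[OF assms] by simp
qed

lemma act_plus: "act (u + u') v = (\<lambda>n. act u v n + act u' v n)"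
  unfolding act_def by (rule ext, rule setsum_keys_plus_distrib) (simp_all add: distrib_right)

lemma act_zero [simp]: "act 0 v = (\<lambda>n. 0)"
  by (simp add: act_def fun_eq_iff)

lemma act_single: "act (Poly_Mapping.single w s) v = (\<lambda>n. s * fold step (letters w) v n)"
  by (rule ext) (simp add: act_def)

lemma act_add: "act u (\<lambda>n. v n + v' n) = (\<lambda>n. act u v n + act u v' n)"
  by (rule ext) (simp add: act_def fold_step_add sum.distrib distrib_left)

lemma act_scale: "act u (\<lambda>n. s * v n) = (\<lambda>n. s * act u v n)"
  by (rule ext) (simp add: act_def fold_step_scale sum_distrib_left mult.left_commute)

lemma act_times: "act (u * u') v = act u' (act u v)"
proof (induction u rule: free_alg_induct)
  case zero
  show ?case using act_scale[of u' 0 "\<lambda>n. 0"] by simp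
next
  case (add u1 u2)
  then show ?case by (simp add: distrib_right act_plus act_add)
next
  case (single w s)
  show ?case
  proof (induction u' rule: free_alg_induct)
    case (single w' s')
    show ?case
      by (simp add: mult_single act_single plus_monomial_def fold_step_scale mult_ac)
  next
    case (add u1 u2)
    then show ?case by (simp add: distrib_left act_plus)
  qed simp
qed

text \<open>The theorem asks for elements that are sets of algebra elements, so v is stored as the
  set of all terms v(n) c^n. A nonzero term reveals its n; all vanishing ones collapse to 0, and
  this loses nothing.\<close>

definition encode :: "(nat \<Rightarrow> 'k) \<Rightarrow> ('k, 'x) free_alg set"
  where "encode v = range (\<lambda>n. Poly_Mapping.single (Monomial (replicate n c)) (v n))"

lemma inj_encode: "inj encode"
proof -
  have eq: "v' n = v n" if "encode v = encode v'" "v n \<noteq> 0" for v v' n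
  proof -
    have "Poly_Mapping.single (Monomial (replicate n c)) (v n) \<in> encode v'"
      using that(1) by (auto simp: encode_def)
    then obtain m where m: "Poly_Mapping.single (Monomial (replicate n c)) (v n)
        = Poly_Mapping.single (Monomial (replicate m c)) (v' m)" by (auto simp: encode_def)
    have "v n = (v' m when Monomial (replicate m c) = Monomial (replicate n c))"
      using arg_cong[OF m, of "\<lambda>u. Poly_Mapping.lookup u (Monomial (replicate n c))"] by (simp add: lookup_single)
    then show ?thesis using that(2) by (auto simp: when_def split: if_splits dest: arg_cong[of _ _ length])
  qed
  show ?thesis
  proof (rule injI, rule ext)
    fix v v' :: "nat \<Rightarrow> 'k" and n assume "encode v = encode v'"
    then show "v n = v' n" using eq[of v v' n] eq[of v' v n] by metis
  qed
qed

definition decode :: "('k, 'x) free_alg set \<Rightarrow> nat \<Rightarrow> 'k"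
  where "decode = inv_into UNIV encode"

lemma decode_encode [simp]: "decode (encode v) = v"
  unfolding decode_def by (rule inv_into_f_f[OF inj_encode UNIV_I])

definition model :: "(('k, 'x) free_alg, ('k, 'x) free_alg set) module"
  where "model = \<lparr>carrier = encode ` {v. finite {n. v n \<noteq> 0}}, mult = (\<lambda>X Y. X), one = encode (\<lambda>n. 0),
    zero = encode (\<lambda>n. 0), add = (\<lambda>X Y. encode (\<lambda>n. decode X n + decode Y n)),
    smult = (\<lambda>u X. encode (act u (decode X)))\<rparr>"

lemma finite_support_add:
  "finite {n. v n \<noteq> 0} \<Longrightarrow> finite {n. v' n \<noteq> 0} \<Longrightarrow> finite {n. v n + v' n \<noteq> (0 :: 'k)}"
  by (rule finite_subset[of _ "{n. v n \<noteq> 0} \<union> {n. v' n \<noteq> 0}"]) auto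

lemma right_module_model: "right_module model"
proof -
  have "abelian_group model"
  proof (rule abelian_groupI)
    fix X assume "X \<in> carrier model"
    then obtain v where v: "X = encode v" "finite {n. v n \<noteq> 0}" by (auto simp: model_def)
    then show "\<exists>Y\<in>carrier model. Y \<oplus>\<^bsub>model\<^esub> X = \<zero>\<^bsub>model\<^esub>"
      by (intro bexI[of _ "encode (\<lambda>n. - v n)"]) (auto simp: model_def)
  qed (auto simp: model_def finite_support_add add_ac)
  moreover have "act 1 v = v" for v
  proof -
    have one: "(1 :: ('k, 'x) free_alg) = Poly_Mapping.single (Monomial []) 1" by (simp flip: zero_monomial_def)
    show ?thesis unfolding one act_single by simp
  qed
  ultimately show ?thesis
    by (auto simp: right_module_def right_module_axioms_def model_def finite_support_act act_plus act_add act_times)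
qed

lemma tree_module_model: "tree_module c a lev par lab model (decode)"
proof -
  interpret right_module model by (rule right_module_model)
  show ?thesis
  proof
    show "inj_on (decode) (carrier model)"
      by (auto simp: model_def inj_on_def)
    show "decode ` carrier model = {v. finite {n. v n \<noteq> 0}}"
      by (auto simp: model_def image_image)
  qed (auto simp: model_def const_def var_def act_single zero_monomial_def)
qed

end

theorem theorem4:
  assumes "infinite (UNIV :: 'k::field set)"
    and "card (UNIV :: 'x::finite set) > 1"
  shows "\<exists>(\<alpha> :: 'x \<Rightarrow> nat \<Rightarrow> 'k) (M :: (('k, 'x) free_alg, ('k, 'x) free_alg set) module).
    (\<forall>i\<ge>1. ideal (Delta \<alpha> i) class_ring) \<and>
    cyclic_module M \<and>
    maximal_growth M \<and>
    triangular M \<and>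
    (\<forall>N. is_submodule N M \<longrightarrow>
      (\<Inter>i\<in>{1..}. Delta_product (factor_module M N) \<alpha> i) = {\<zero>\<^bsub>factor_module M N\<^esub>}) \<and>
    residually_finite M \<and>
    (\<forall>N. is_submodule N M \<longrightarrow> residually_finite (factor_module M N)) \<and>
    (\<forall>Q :: (('k, 'x) free_alg, ('k, 'x) free_alg set set) module.
      is_section Q M \<longrightarrow> simple_module Q \<longrightarrow> one_dimensional Q)"
proof -
  obtain a :: "nat \<Rightarrow> 'k" where "inj a" using infinite_countable_subset[OF assms(1)] by blast
  \<comment> \<open>Any letter may act diagonally; the infinite field supplies its distinct
    eigenvalues.\<close>
  obtain c :: 'x where True by blast
  obtain lev par lab where "block_tree c a lev par lab"
    using ex_block_tree[OF assms(2) \<open>inj a\<close>] by blast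
  then interpret block_tree c a lev par lab .
  interpret tree_module c a lev par lab model decode by (rule tree_module_model)
  show ?thesis
    using ideal_Delta cyclic_M maximal_growth_M[OF assms(2)] triangular_M Inter_Delta_product
      residually_finite_M residually_finite_factor one_dimensional_simple_section by blast
qed

end
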